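(* Let $T$ be an ordered tree bigraph of radius $r$ with $t\ge 2$ vertices. Let $n\ge 1$ be an integer, and let $G$ be an ordered bigraph that does not contain $T$, with $|V_1(G)|,|V_2(G)|\ge n$, such that every vertex of $G$ has degree at most $n/(4t^2)$. Let $K\ge 0$ be the real number with $t^{K^r}=n$. Then there are subsets $Z_i\subseteq V_i(G)$ for $i=1,2$, with $|Z_1|,|Z_2|\ge n\,t^{-5K^{r-1}}$, such that $Z_1,Z_2$ are anticomplete (where $K^{0}=1$).
   Context: All graphs are finite, with no loops or parallel edges. A bigraph is a graph $G$ together with a bipartition $(V_1(G),V_2(G))$ of its vertex set (the two parts are disjoint with union $V(G)$, and every edge joins a vertex of $V_1(G)$ to a vertex of $V_2(G)$). An ordered bigraph is a bigraph with a linear order on $V_1(G)$ and a linear order on $V_2(G)$. An ordered bigraph $G$ contains an ordered bigraph $H$ if there is an induced subgraph $H'$ of $G$ and a graph isomorphism from $H$ to $H'$ mapping $V_i(H)$ into $V_i(G)$ for $i=1,2$ and carrying the order of $V_i(H)$ to the order inherited from $V_i(G)$, for $i=1,2$. An ordered tree bigraph is an ordered bigraph whose underlying graph is a tree. The radius of a tree $T$ is the minimum $r$ such that for some vertex $v$, every vertex of $T$ can be joined to $v$ by a path with at most $r$ edges. Two disjoint sets of vertices are anticomplete if there are no edges between them. *)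

theory Defs
  imports Complex_Main "Graph_Theory.Graph_Theory"
begin

text \<open>
  The underlying graph is a symmetric, loop-free set of arcs (\<^locale>\<open>pair_graph\<close>):
  an undirected edge \<open>uv\<close> is the pair of arcs \<open>(u, v)\<close>, \<open>(v, u)\<close>.
\<close>

record 'a obigraph =
  ugraph :: "'a pair_pre_digraph"
  part1 :: "'a set"
  part2 :: "'a set"
  ord1 :: "'a rel"
  ord2 :: "'a rel"

locale bigraph = pair_graph "ugraph B" for B :: "'a obigraph" +
  assumes parts_disjoint: "part1 B \<inter> part2 B = {}"
    and parts_cover: "part1 B \<union> part2 B = pverts (ugraph B)"
    and arcs_between_parts: "\<And>u v. (u, v) \<in> parcs (ugraph B) \<Longrightarrow>
      u \<in> part1 B \<and> v \<in> part2 B \<or> u \<in> part2 B \<and> v \<in> part1 B"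

locale ordered_bigraph = bigraph +
  assumes linear_ord1: "linear_order_on (part1 B) (ord1 B)"
    and linear_ord2: "linear_order_on (part2 B) (ord2 B)"

text \<open>
  \<open>h\<close> is an isomorphism from \<open>H\<close> onto the graph \<open>app_iso h H\<close>, which is required to be an
  induced subgraph of \<open>G\<close>.
\<close>

definition contains :: "'a obigraph \<Rightarrow> 'b obigraph \<Rightarrow> bool" where
  "contains G H \<longleftrightarrow> (\<exists>h.
     pre_digraph.digraph_isomorphism (with_proj (ugraph H)) h \<and>
     induced_subgraph (app_iso h (with_proj (ugraph H))) (with_proj (ugraph G)) \<and>
     iso_verts h ` part1 H \<subseteq> part1 G \<and>
     iso_verts h ` part2 H \<subseteq> part2 G \<and>
     (\<forall>x\<in>part1 H. \<forall>y\<in>part1 H.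
        (x, y) \<in> ord1 H \<longleftrightarrow> (iso_verts h x, iso_verts h y) \<in> ord1 G) \<and>
     (\<forall>x\<in>part2 H. \<forall>y\<in>part2 H.
        (x, y) \<in> ord2 H \<longleftrightarrow> (iso_verts h x, iso_verts h y) \<in> ord2 G))"

text \<open>
  The predicate \<^const>\<open>tree\<close> of the library is not usable for symmetric digraphs: it counts
  the closed walk \<open>u, v, u\<close> along a single edge as a cycle. The cycles of the undirected
  graph are those with at least three arcs.
\<close>

definition undirected_tree :: "'a pair_pre_digraph \<Rightarrow> bool" where
  "undirected_tree T \<longleftrightarrow> pair_graph T \<and> connected (with_proj T) \<and>
     \<not> (\<exists>p. pre_digraph.cycle (with_proj T) p \<and> 3 \<le> length p)"

definition ordered_tree_bigraph :: "'a obigraph \<Rightarrow> bool" where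
  "ordered_tree_bigraph T \<longleftrightarrow> ordered_bigraph T \<and> undirected_tree (ugraph T)"

definition radius :: "'a pair_pre_digraph \<Rightarrow> nat" where
  "radius T = (LEAST r. \<exists>v\<in>pverts T. \<forall>u\<in>pverts T.
     \<exists>p. pre_digraph.apath (with_proj T) u p v \<and> length p \<le> r)"

definition anticomplete :: "'a pair_pre_digraph \<Rightarrow> 'a set \<Rightarrow> 'a set \<Rightarrow> bool" where
  "anticomplete G X Y \<longleftrightarrow> X \<inter> Y = {} \<and> (\<forall>x\<in>X. \<forall>y\<in>Y. (x, y) \<notin> parcs G)"

text \<open>Containment in terms of the vertex map alone.\<close>

lemma contains_iff:
  assumes "ordered_bigraph G" "ordered_bigraph H"
  shows "contains G H \<longleftrightarrow> (\<exists>f.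
     inj_on f (pverts (ugraph H)) \<and>
     (\<forall>u\<in>pverts (ugraph H). \<forall>v\<in>pverts (ugraph H).
        (u, v) \<in> parcs (ugraph H) \<longleftrightarrow> (f u, f v) \<in> parcs (ugraph G)) \<and>
     f ` part1 H \<subseteq> part1 G \<and> f ` part2 H \<subseteq> part2 G \<and>
     (\<forall>x\<in>part1 H. \<forall>y\<in>part1 H. (x, y) \<in> ord1 H \<longleftrightarrow> (f x, f y) \<in> ord1 G) \<and>
     (\<forall>x\<in>part2 H. \<forall>y\<in>part2 H. (x, y) \<in> ord2 H \<longleftrightarrow> (f x, f y) \<in> ord2 G))"
    (is "_ \<longleftrightarrow> (\<exists>f. ?P f)")
proof
  interpret G: ordered_bigraph G by fact
  interpret H: ordered_bigraph H by fact
  let ?G = "with_proj (ugraph G)" and ?H = "with_proj (ugraph H)"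
  {
    assume "contains G H"
    then obtain h where iso: "pre_digraph.digraph_isomorphism ?H h"
      and ind: "induced_subgraph (app_iso h ?H) ?G"
      and parts: "iso_verts h ` part1 H \<subseteq> part1 G" "iso_verts h ` part2 H \<subseteq> part2 G"
      and ords: "\<forall>x\<in>part1 H. \<forall>y\<in>part1 H.
          (x, y) \<in> ord1 H \<longleftrightarrow> (iso_verts h x, iso_verts h y) \<in> ord1 G"
        "\<forall>x\<in>part2 H. \<forall>y\<in>part2 H.
          (x, y) \<in> ord2 H \<longleftrightarrow> (iso_verts h x, iso_verts h y) \<in> ord2 G"
      unfolding contains_def by blast
    let ?f = "iso_verts h"
    have inj: "inj_on ?f (pverts (ugraph H))"
      using iso by (simp add: pre_digraph.digraph_isomorphism_def)
    have th: "iso_tail h = fst" "iso_head h = snd"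
      using ind by (auto simp: induced_subgraph_def subgraph_def compatible_def)
    have arc: "iso_arcs h a = (?f (fst a), ?f (snd a))" if "a \<in> parcs (ugraph H)" for a
      using iso that by (auto simp: pre_digraph.digraph_isomorphism_def th prod_eq_iff)
    have arcs: "iso_arcs h ` parcs (ugraph H) = {e \<in> parcs (ugraph G).
        fst e \<in> ?f ` pverts (ugraph H) \<and> snd e \<in> ?f ` pverts (ugraph H)}"
      using ind by (simp add: induced_subgraph_def)
    have "(u, v) \<in> parcs (ugraph H) \<longleftrightarrow> (?f u, ?f v) \<in> parcs (ugraph G)"
      if uv: "u \<in> pverts (ugraph H)" "v \<in> pverts (ugraph H)" for u v
    proof
      assume "(u, v) \<in> parcs (ugraph H)"
      then have "(?f u, ?f v) \<in> iso_arcs h ` parcs (ugraph H)"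
        using arc[of "(u, v)"] by force
      then show "(?f u, ?f v) \<in> parcs (ugraph G)" unfolding arcs by blast
    next
      assume "(?f u, ?f v) \<in> parcs (ugraph G)"
      then have "(?f u, ?f v) \<in> iso_arcs h ` parcs (ugraph H)"
        unfolding arcs using uv by auto
      then obtain a where a: "a \<in> parcs (ugraph H)" "(?f u, ?f v) = iso_arcs h a" by blast
      then have "?f u = ?f (fst a)" "?f v = ?f (snd a)" using arc by auto
      then have "u = fst a" "v = snd a"
        using inj uv H.arc_fst_in_verts[OF a(1)] H.arc_snd_in_verts[OF a(1)]
        by (auto dest: inj_onD)
      then show "(u, v) \<in> parcs (ugraph H)" using a by simp
    qed
    then show "\<exists>f. ?P f" using inj parts ords by blast
  }
  {
    assume "\<exists>f. ?P f"
    then obtain f where f: "?P f" ..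
    define h where "h = \<lparr>iso_verts = f, iso_arcs = (\<lambda>a. (f (fst a), f (snd a))),
      iso_head = snd, iso_tail = fst\<rparr>"
    have hs [simp]: "iso_verts h = f" "iso_arcs h = (\<lambda>a. (f (fst a), f (snd a)))"
      "iso_head h = snd" "iso_tail h = fst"
      by (simp_all add: h_def)
    have inj: "inj_on f (pverts (ugraph H))" using f by blast
    have "inj_on (\<lambda>a. (f (fst a), f (snd a))) (parcs (ugraph H))"
    proof (rule inj_onI)
      fix a b assume ab: "a \<in> parcs (ugraph H)" "b \<in> parcs (ugraph H)"
        "(f (fst a), f (snd a)) = (f (fst b), f (snd b))"
      then show "a = b"
        using inj_onD[OF inj, of "fst a" "fst b"] inj_onD[OF inj, of "snd a" "snd b"]
          H.arc_fst_in_verts H.arc_snd_in_verts by (simp add: prod_eq_iff)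
    qed
    then have iso: "pre_digraph.digraph_isomorphism ?H h"
      using inj H.wf_digraph by (simp add: pre_digraph.digraph_isomorphism_def)
    have wf: "wf_digraph (app_iso h ?H)"
      using iso by (rule H.wf_digraphI_app_iso)
    have verts: "f ` pverts (ugraph H) \<subseteq> pverts (ugraph G)"
      using f H.parts_cover G.parts_cover by blast
    have arcs: "(\<lambda>a. (f (fst a), f (snd a))) ` parcs (ugraph H) = {e \<in> parcs (ugraph G).
        fst e \<in> f ` pverts (ugraph H) \<and> snd e \<in> f ` pverts (ugraph H)}" (is "?L = ?R")
    proof
      show "?L \<subseteq> ?R"
      proof
        fix e assume "e \<in> ?L"
        then obtain u v where uv: "(u, v) \<in> parcs (ugraph H)" "e = (f u, f v)" by auto
        then have "u \<in> pverts (ugraph H)" "v \<in> pverts (ugraph H)"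
          using H.in_arcsD1 H.in_arcsD2 by blast+
        then show "e \<in> ?R" using uv f by auto
      qed
      show "?R \<subseteq> ?L"
      proof
        fix e assume e: "e \<in> ?R"
        then obtain u v where uv: "u \<in> pverts (ugraph H)" "v \<in> pverts (ugraph H)"
          "e = (f u, f v)" by (cases e) auto
        then have "(u, v) \<in> parcs (ugraph H)" using e f by blast
        then show "e \<in> ?L" using uv by force
      qed
    qed
    have "induced_subgraph (app_iso h ?H) ?G"
      unfolding induced_subgraph_def subgraph_def compatible_def
      using wf verts arcs G.wf_digraph by auto
    then show "contains G H"
      unfolding contains_def using iso f by (intro exI[of _ h]) simp
  }
qed

end

theory Submission
  imports Defs
begin

text \<open>
  Write \<open>z = n t powr (- 5 K ^ (r - 1))\<close> and suppose that no anticomplete pair of size \<open>z\<close>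
  exists. If \<open>K \<le> 5\<close> then \<open>z \<le> 1\<close> and a nonadjacent pair of vertices is such a pair, so let
  \<open>K > 5\<close>. The proof finds \<open>T\<close> in \<open>G\<close>.

  Passing to subsets of the two parts, trade size for degree at the rate \<open>K\<close>: losing a factor
  \<open>y\<close> in size is acceptable if the maximum degree drops by the factor \<open>y powr K\<close>. A pair
  \<open>A1, A2\<close>, of size \<open>m\<close> and maximum degree \<open>\<Delta>\<close>, where this exchange cannot be continued is
  robust (\<open>extremal_pair\<close>): as long as \<open>m / y \<ge> z\<close>, for any subsets of \<open>A1\<close> and \<open>A2\<close> of sizes
  about \<open>m / y\<close>, some vertex of the one has at least \<open>max 1 (\<Delta> y powr - K)\<close> neighbours in the
  other. At most the factor \<open>t powr (K ^ (r - 1))\<close> of the size has been lost.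

  Cut \<open>A1\<close> and \<open>A2\<close> into consecutive blocks, one for each vertex of \<open>T\<close> (\<open>ordered_blocks\<close>).
  An induced copy of the unordered tree with every vertex in its own block is automatically
  order preserving, so the orders disappear from the problem (\<open>contains_if_block_map\<close>).

  Root \<open>T\<close> at a centre. By induction over subtrees, every set \<open>D\<close> of \<open>m / y\<close> vertices in the
  block of a tree vertex \<open>u\<close> contains the root of a copy of the subtree below \<open>u\<close>
  (\<open>rooted_copy\<close>), where the tolerated loss \<open>y\<close> at depth \<open>d + 1\<close> is about the \<open>K\<close>-th power of that
  at depth \<open>d\<close>. Indeed, take \<open>v\<close> in \<open>D\<close> with many neighbours in the blocks of all children of
  \<open>u\<close>, and try to build the copy greedily, one child subtree after the other. If this gets
  stuck, then at some child \<open>c\<close>, half of the neighbours of \<open>v\<close> in the block of \<open>c\<close> are not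
  roots of copies of the subtree below \<open>c\<close> outside a set \<open>Z\<close> of only \<open>O(t \<Delta>)\<close> vertices per
  block (\<open>copy_or_blocked_child\<close>). Collect such failures over several \<open>v\<close>: when the blocked
  neighbours amount to the size needed at the next depth, the sets \<open>Z\<close> together still cover
  less than the blocks, and the induction hypothesis for \<open>c\<close> is violated.

  The losses at depths \<open>0, ..., r - 1\<close> start with \<open>t ^ 3\<close> and go from \<open>y\<close> to at most
  \<open>t ^ 8 y powr K\<close>; the last one together with the loss of the extremal pair fits into
  \<open>t powr (5 K ^ (r - 1))\<close> because \<open>K \<ge> 5\<close> (\<open>loss_le\<close>).
\<close>

section \<open>Removing the vertex sets that cover half of a given set\<close>

text \<open>
  Removing single vertices of high degree to \<open>D\<close> would be too expensive for the constant in the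
  degree bound. Instead take a maximal family of disjoint sets that each see more than half of
  \<open>D\<close>: every vertex of \<open>D\<close> is seen by at most \<open>\<Delta>\<close> members, so by double counting there are at
  most \<open>2 \<Delta>\<close> of them. The predicate \<open>P\<close> will say that a set meets every block at most once, so
  that the removal costs at most \<open>2 \<Delta>\<close> vertices in each block.
\<close>

lemma killer_removal:
  fixes E :: "'b \<Rightarrow> 'b \<Rightarrow> bool" and \<Delta> :: real
  assumes W: "finite W" and D: "finite D" "D \<noteq> {}"
    and deg: "\<And>x. x \<in> D \<Longrightarrow> real (card {y \<in> W. E y x}) \<le> \<Delta>"
  shows "\<exists>\<K>. finite \<K> \<and> real (card \<K>) \<le> 2 * \<Delta> \<and> (\<forall>U\<in>\<K>. U \<subseteq> W \<and> P U) \<and>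
    (\<forall>U. U \<subseteq> W - \<Union>\<K> \<longrightarrow> P U \<longrightarrow> 2 * card {x \<in> D. \<exists>y\<in>U. E y x} \<le> card D)"
proof -
  define N where "N U = {x \<in> D. \<exists>y\<in>U. E y x}" for U
  define kill where "kill = {U. U \<subseteq> W \<and> P U \<and> card D < 2 * card (N U)}"
  define \<F> where "\<F> = {\<K>. \<K> \<subseteq> kill \<and> pairwise disjnt \<K>}"
  have kill_fin: "finite kill"
    by (rule finite_subset[of _ "Pow W"]) (use W in \<open>auto simp: kill_def\<close>)
  have "finite \<F>"
    by (rule finite_subset[of _ "Pow kill"]) (use kill_fin in \<open>auto simp: \<F>_def\<close>)
  moreover have "{} \<in> \<F>" by (simp add: \<F>_def pairwise_def disjnt_def)
  ultimately obtain \<K> where \<K>: "\<K> \<in> \<F>" and max: "\<And>\<L>. \<L> \<in> \<F> \<Longrightarrow> \<K> \<subseteq> \<L> \<Longrightarrow> \<K> = \<L>"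
    using finite_has_maximal[of \<F>] by blast
  have sub: "\<K> \<subseteq> kill" and dis: "pairwise disjnt \<K>" using \<K> by (auto simp: \<F>_def)
  have fin: "finite \<K>" using sub kill_fin by (rule finite_subset)
  have "card \<K> * card D \<le> (\<Sum>U\<in>\<K>. 2 * card (N U))"
    using sum_mono[of \<K> "\<lambda>_. card D" "\<lambda>U. 2 * card (N U)"] sub by (force simp: kill_def)
  also have "\<dots> = 2 * (\<Sum>U\<in>\<K>. card (N U))" by (simp add: sum_distrib_left)
  also have "(\<Sum>U\<in>\<K>. card (N U)) = (\<Sum>U\<in>\<K>. \<Sum>x\<in>D. if \<exists>y\<in>U. E y x then 1 else 0)"
    by (rule sum.cong[OF refl]) (simp add: N_def D sum.If_cases Int_def)
  also have "\<dots> = (\<Sum>x\<in>D. \<Sum>U\<in>\<K>. if \<exists>y\<in>U. E y x then 1 else 0)"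
    by (rule sum.swap)
  also have "\<dots> = (\<Sum>x\<in>D. card {U\<in>\<K>. \<exists>y\<in>U. E y x})"
    by (rule sum.cong[OF refl]) (simp add: fin sum.If_cases Int_def)
  also have "\<dots> \<le> (\<Sum>x\<in>D. card {y \<in> W. E y x})"
  proof (rule sum_mono)
    fix x assume "x \<in> D"
    define g where "g U = (SOME y. y \<in> U \<and> E y x)" for U
    have g: "g U \<in> U \<and> E (g U) x" if "\<exists>y\<in>U. E y x" for U
      unfolding g_def using someI_ex[of "\<lambda>y. y \<in> U \<and> E y x"] that by blast
    show "card {U\<in>\<K>. \<exists>y\<in>U. E y x} \<le> card {y \<in> W. E y x}"
    proof (rule card_inj_on_le[of g])
      show "inj_on g {U\<in>\<K>. \<exists>y\<in>U. E y x}"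
      proof (rule inj_onI)
        fix U U' assume *: "U \<in> {U\<in>\<K>. \<exists>y\<in>U. E y x}" "U' \<in> {U\<in>\<K>. \<exists>y\<in>U. E y x}" "g U = g U'"
        have "g U \<in> U \<inter> U'" using g[of U] g[of U'] * by auto
        then show "U = U'" using dis * unfolding pairwise_def disjnt_def by blast
      qed
      show "g ` {U\<in>\<K>. \<exists>y\<in>U. E y x} \<subseteq> {y \<in> W. E y x}"
        using g sub unfolding kill_def by blast
    qed (use W in simp)
  qed
  finally have "card \<K> * card D \<le> 2 * (\<Sum>x\<in>D. card {y \<in> W. E y x})" by simp
  then have "real (card \<K> * card D) \<le> real (2 * (\<Sum>x\<in>D. card {y \<in> W. E y x}))"
    unfolding of_nat_le_iff .
  then have "real (card \<K>) * real (card D) \<le> 2 * (\<Sum>x\<in>D. real (card {y \<in> W. E y x}))"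
    by (simp only: of_nat_mult of_nat_sum of_nat_numeral)
  also have "\<dots> \<le> 2 * (\<Sum>x\<in>D. \<Delta>)" using deg by (intro mult_left_mono sum_mono) simp_all
  also have "\<dots> = 2 * \<Delta> * real (card D)" by simp
  finally have card: "real (card \<K>) \<le> 2 * \<Delta>"
    using D by (simp add: card_gt_0_iff)
  have "2 * card (N U) \<le> card D" if U: "U \<subseteq> W - \<Union>\<K>" "P U" for U
  proof (rule ccontr)
    assume "\<not> ?thesis"
    then have kU: "U \<in> kill" using U by (auto simp: kill_def)
    have "pairwise disjnt (insert U \<K>)" using dis U unfolding pairwise_def disjnt_def by blast
    then have "insert U \<K> \<in> \<F>" using kU sub by (auto simp: \<F>_def)
    then have "U \<in> \<K>" using max by blast
    then have "U = {}" using U by blast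
    then show False using kU by (simp add: kill_def N_def)
  qed
  then show ?thesis using fin card sub unfolding N_def kill_def by blast
qed

section \<open>Rooted trees\<close>

text \<open>
  \<open>rooted_tree A r d u S\<close>: the vertices \<open>S\<close> induce a tree in \<open>A\<close> with root \<open>u\<close>, where \<open>u\<close> counts
  as lying at depth \<open>d\<close> and all depths are at most \<open>r\<close>. Depths rather than heights are recorded
  because the sizes in the embedding argument depend on the depth.
\<close>

inductive rooted_tree :: "('a \<Rightarrow> 'a \<Rightarrow> bool) \<Rightarrow> nat \<Rightarrow> nat \<Rightarrow> 'a \<Rightarrow> 'a set \<Rightarrow> bool"
  for A :: "'a \<Rightarrow> 'a \<Rightarrow> bool" and r :: nat where
  node: "finite C \<Longrightarrow> (C \<noteq> {} \<Longrightarrow> d < r) \<Longrightarrow>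
    (\<And>c. c \<in> C \<Longrightarrow> rooted_tree A r (Suc d) c (S c)) \<Longrightarrow>
    (\<And>c. c \<in> C \<Longrightarrow> u \<notin> S c) \<Longrightarrow>
    (\<And>c c'. c \<in> C \<Longrightarrow> c' \<in> C \<Longrightarrow> c \<noteq> c' \<Longrightarrow> S c \<inter> S c' = {}) \<Longrightarrow>
    (\<And>c x. c \<in> C \<Longrightarrow> x \<in> S c \<Longrightarrow> A u x \<longleftrightarrow> x = c) \<Longrightarrow>
    (\<And>c c' x y. c \<in> C \<Longrightarrow> c' \<in> C \<Longrightarrow> c \<noteq> c' \<Longrightarrow> x \<in> S c \<Longrightarrow> y \<in> S c' \<Longrightarrow> \<not> A x y) \<Longrightarrow>
    rooted_tree A r d u (insert u (\<Union>c\<in>C. S c))"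

lemma rooted_tree_root: "rooted_tree A r d u S \<Longrightarrow> u \<in> S"
  by (erule rooted_tree.cases) auto

lemma rooted_tree_finite: "rooted_tree A r d u S \<Longrightarrow> finite S"
  by (induction rule: rooted_tree.induct) auto

section \<open>Embedding a rooted tree into blocks\<close>

text \<open>
  \<open>B x\<close> is the block in which the image of the tree vertex \<open>x\<close> has to lie. Both graphs are bipartite,
  and \<open>side\<close> tells to which part a tree vertex and the vertices of its block belong.
\<close>

locale blocks =
  fixes A :: "'a \<Rightarrow> 'a \<Rightarrow> bool" and side :: "'a \<Rightarrow> bool"
    and E :: "'b \<Rightarrow> 'b \<Rightarrow> bool" and B :: "'a \<Rightarrow> 'b set" and V :: "'b set" and \<Delta> :: real
  assumes A_sym: "A x y \<Longrightarrow> A y x"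
    and A_side: "A x y \<Longrightarrow> side x \<noteq> side y"
    and E_sym: "E v w \<Longrightarrow> E w v"
    and E_side: "v \<in> B x \<Longrightarrow> w \<in> B y \<Longrightarrow> E v w \<Longrightarrow> side x \<noteq> side y"
    and V_fin: "finite V"
    and B_sub: "B x \<subseteq> V"
    and B_disj: "x \<noteq> y \<Longrightarrow> B x \<inter> B y = {}"
    and deg: "v \<in> V \<Longrightarrow> real (card {w \<in> V. E v w}) \<le> \<Delta>"
begin

definition embeds :: "'a set \<Rightarrow> ('a \<Rightarrow> 'b) \<Rightarrow> bool" where
  "embeds S f \<longleftrightarrow> (\<forall>x\<in>S. \<forall>y\<in>S. E (f x) (f y) \<longleftrightarrow> A x y)"

text \<open>
  The root is exempt from avoiding \<open>X\<close>: in the induction it ranges over a set of candidates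
  that is chosen before further vertices are forbidden.
\<close>

definition extends :: "'a set \<Rightarrow> 'a \<Rightarrow> 'b set \<Rightarrow> 'b \<Rightarrow> bool" where
  "extends S u X v \<longleftrightarrow> (\<exists>f. f u = v \<and> (\<forall>x\<in>S - {u}. f x \<in> B x - X) \<and> embeds S f)"

lemma extends_mono: "extends S u X v \<Longrightarrow> X' \<subseteq> X \<Longrightarrow> extends S u X' v"
  unfolding extends_def by blast

lemma B_fin: "finite (B x)" using B_sub V_fin finite_subset by blast

lemma no_loop: "\<not> A x x" using A_side by blast

lemma E_no_loop: "v \<in> B x \<Longrightarrow> \<not> E v v" using E_side by blast

lemma \<Delta>_nonneg: "v \<in> V \<Longrightarrow> 0 \<le> \<Delta>" using deg[of v] by linarith

text \<open>
  The greedy construction of a copy rooted at \<open>v\<close>. A new subtree below \<open>c\<close> must avoid the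
  neighbours of the part \<open>F\<close> built so far, which are few, and its root must be a vertex of \<open>D c\<close>
  without a neighbour in \<open>F\<close>. The latter leaves at least half of \<open>D c\<close>, provided that from the
  start the copy avoids the sets \<open>\<K> c\<close> given by the lemma \<open>killer_removal\<close>. If no root works, then
  \<open>Z\<close> consists of the neighbours of \<open>F\<close> and of the sets \<open>\<K>\<close>. Its size is bounded in terms of
  \<open>card T - card (S c)\<close>, not of \<open>card T\<close>, so that the costs add up to \<open>3 t \<Delta>\<close> along a
  descending path of the tree.
\<close>

lemma copy_or_blocked_child:
  fixes u :: 'a and S :: "'a \<Rightarrow> 'a set" and C :: "'a set" and D :: "'a \<Rightarrow> 'b set"
  defines "T \<equiv> insert u (\<Union>c\<in>C. S c)"
  assumes C: "finite C"
    and fin: "\<And>c. c \<in> C \<Longrightarrow> finite (S c)"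
    and root: "\<And>c. c \<in> C \<Longrightarrow> c \<in> S c"
    and u: "\<And>c. c \<in> C \<Longrightarrow> u \<notin> S c"
    and dis: "\<And>c c'. c \<in> C \<Longrightarrow> c' \<in> C \<Longrightarrow> c \<noteq> c' \<Longrightarrow> S c \<inter> S c' = {}"
    and Au: "\<And>c x. c \<in> C \<Longrightarrow> x \<in> S c \<Longrightarrow> A u x \<longleftrightarrow> x = c"
    and nA: "\<And>c c' x y. c \<in> C \<Longrightarrow> c' \<in> C \<Longrightarrow> c \<noteq> c' \<Longrightarrow> x \<in> S c \<Longrightarrow> y \<in> S c' \<Longrightarrow> \<not> A x y"
    and v: "v \<in> B u"
    and D: "\<And>c. c \<in> C \<Longrightarrow> D c \<subseteq> {w \<in> B c - X. E v w}"
    and D_ne: "\<And>c. c \<in> C \<Longrightarrow> D c \<noteq> {}"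
    and no: "\<not> extends T u X v"
  shows "\<exists>c\<in>C. \<exists>D' Z. D' \<subseteq> D c \<and> card (D c) \<le> 2 * card D' \<and>
    (\<forall>x. real (card (Z \<inter> B x)) \<le> 3 * real (card T - card (S c)) * \<Delta>) \<and>
    (\<forall>w\<in>D'. \<not> extends (S c) c (X \<union> Z) w)"
proof (rule ccontr)
  assume contr: "\<not> ?thesis"
  have \<Delta>0: "0 \<le> \<Delta>" using v B_sub \<Delta>_nonneg by blast
  have T_fin: "finite T" using C fin by (auto simp: T_def)
  define W where "W = (\<Union>x\<in>{x \<in> T - {u}. side x = side u}. B x)"
  have W_fin: "finite W" using T_fin B_fin by (auto simp: W_def)
  define trans where "trans U \<longleftrightarrow> (\<forall>x. card (U \<inter> B x) \<le> 1)" for U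
  have "\<forall>c\<in>C. \<exists>\<K>. finite \<K> \<and> real (card \<K>) \<le> 2 * \<Delta> \<and> (\<forall>U\<in>\<K>. U \<subseteq> W \<and> trans U) \<and>
    (\<forall>U. U \<subseteq> W - \<Union>\<K> \<longrightarrow> trans U \<longrightarrow> 2 * card {w \<in> D c. \<exists>y\<in>U. E y w} \<le> card (D c))"
  proof
    fix c assume c: "c \<in> C"
    have DB: "D c \<subseteq> B c" using D c by blast
    have "real (card {y \<in> W. E y x}) \<le> \<Delta>" if "x \<in> D c" for x
    proof -
      have xV: "x \<in> V" using that DB B_sub by blast
      have "card {y \<in> W. E y x} \<le> card {w \<in> V. E x w}"
        using B_sub E_sym V_fin by (intro card_mono) (auto simp: W_def)
      then show ?thesis using deg[OF xV] by linarith
    qed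
    then show "\<exists>\<K>. finite \<K> \<and> real (card \<K>) \<le> 2 * \<Delta> \<and> (\<forall>U\<in>\<K>. U \<subseteq> W \<and> trans U) \<and>
      (\<forall>U. U \<subseteq> W - \<Union>\<K> \<longrightarrow> trans U \<longrightarrow> 2 * card {w \<in> D c. \<exists>y\<in>U. E y w} \<le> card (D c))"
      using W_fin DB B_fin finite_subset D_ne[OF c] by (intro killer_removal) blast+
  qed
  from bchoice[OF this] obtain \<K> where *: "\<forall>c\<in>C. finite (\<K> c) \<and> real (card (\<K> c)) \<le> 2 * \<Delta> \<and>
    (\<forall>U\<in>\<K> c. U \<subseteq> W \<and> trans U) \<and>
    (\<forall>U. U \<subseteq> W - \<Union>(\<K> c) \<longrightarrow> trans U \<longrightarrow> 2 * card {w \<in> D c. \<exists>y\<in>U. E y w} \<le> card (D c))" ..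
  have \<K>: "finite (\<K> c)" "real (card (\<K> c)) \<le> 2 * \<Delta>"
      "U \<in> \<K> c \<Longrightarrow> U \<subseteq> W \<and> trans U"
      "U \<subseteq> W - \<Union>(\<K> c) \<Longrightarrow> trans U \<Longrightarrow> 2 * card {w \<in> D c. \<exists>y\<in>U. E y w} \<le> card (D c)"
    if "c \<in> C" for c U
    using bspec[OF * that] by simp_all
  \<comment> \<open>all that is removed in advance, to keep every set of candidate roots half alive\<close>
  define KK where "KK = (\<Union>c\<in>C. \<Union>(\<K> c))"
  have KK: "real (card (KK \<inter> B x)) \<le> 2 * real (card C) * \<Delta>" for x
  proof -
    have "card (KK \<inter> B x) \<le> (\<Sum>c\<in>C. card (\<Union>(\<K> c) \<inter> B x))"
    proof -
      have "KK \<inter> B x = (\<Union>c\<in>C. \<Union>(\<K> c) \<inter> B x)" unfolding KK_def by blast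
      then show ?thesis using card_UN_le[OF C, of "\<lambda>c. \<Union>(\<K> c) \<inter> B x"] by metis
    qed
    also have "real \<dots> \<le> (\<Sum>c\<in>C. 2 * \<Delta>)"
      unfolding of_nat_sum
    proof (rule sum_mono)
      fix c assume c: "c \<in> C"
      have "card (\<Union>(\<K> c) \<inter> B x) \<le> (\<Sum>U\<in>\<K> c. card (U \<inter> B x))"
      proof -
        have "\<Union>(\<K> c) \<inter> B x = (\<Union>U\<in>\<K> c. U \<inter> B x)" by blast
        then show ?thesis using card_UN_le[OF \<K>(1)[OF c], of "\<lambda>U. U \<inter> B x"] by metis
      qed
      also have "\<dots> \<le> (\<Sum>U\<in>\<K> c. 1)" using \<K>(3)[OF c] by (intro sum_mono) (auto simp: trans_def)
      finally show "real (card (\<Union>(\<K> c) \<inter> B x)) \<le> 2 * \<Delta>" using \<K>(2)[OF c] by simp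
    qed
    finally show ?thesis by simp
  qed
  have greedy: "\<exists>f. f u = v \<and> (\<forall>c\<in>J. f c \<in> D c) \<and>
      (\<forall>c\<in>J. \<forall>x\<in>S c - {c}. f x \<in> B x - X - KK - {w. E v w}) \<and> embeds (insert u (\<Union>c\<in>J. S c)) f"
    if "finite J" "J \<subseteq> C" for J
    using that
  proof (induction J rule: finite_induct)
    case empty
    have "embeds {u} (\<lambda>_. v)" using v E_no_loop no_loop by (simp add: embeds_def)
    then show ?case by (intro exI[of _ "\<lambda>_. v"]) simp
  next
    case (insert c J)
    then have c: "c \<in> C" and JC: "J \<subseteq> C" and cJ: "c \<notin> J" by auto
    from insert obtain f where f: "f u = v" "\<And>j. j \<in> J \<Longrightarrow> f j \<in> D j"
      "\<And>j x. j \<in> J \<Longrightarrow> x \<in> S j - {j} \<Longrightarrow> f x \<in> B x - X - KK - {w. E v w}"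
      and emb: "embeds (insert u (\<Union>c\<in>J. S c)) f" by blast
    define F where "F = (\<Union>c\<in>J. S c)"
    have F_fin: "finite F" using insert.hyps fin JC by (auto simp: F_def)
    have uF: "u \<notin> F" using u JC by (auto simp: F_def)
    have FT: "insert u F \<subseteq> T" using JC by (auto simp: F_def T_def)
    have fB: "f x \<in> B x" if x: "x \<in> insert u F" for x
    proof (cases "x = u")
      case True then show ?thesis using f v by simp
    next
      case False
      then obtain j where j: "j \<in> J" "x \<in> S j" using x by (auto simp: F_def)
      show ?thesis
      proof (cases "x = j")
        case True then show ?thesis using f(2)[OF j(1)] D[of j] j JC by blast
      next
        case False then show ?thesis using f(3)[OF j(1), of x] j by blast
      qed
    qed
    have cF: "S c \<inter> insert u F = {}" using dis[OF c] u[OF c] JC cJ by (fastforce simp: F_def)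
    define NF where "NF = (\<Union>x\<in>insert u F. {w \<in> V. E (f x) w})"
    define Z where "Z = KK \<union> NF"
    define D' where "D' = {w \<in> D c. \<not> (\<exists>x\<in>F. E (f x) w)}"
    \<comment> \<open>By bipartiteness only the vertices on the side of \<open>u\<close> can be adjacent to \<open>D c\<close>. The root
      \<open>u\<close> itself is adjacent to all of \<open>D c\<close>, as it should be.\<close>
    define U where "U = f ` {x \<in> F. side x = side u}"
    have Dfin: "finite (D c)" using D[OF c] B_fin[of c] by (auto intro: finite_subset)
    have "U \<subseteq> W - \<Union>(\<K> c)"
    proof
      fix y assume "y \<in> U"
      then obtain x j where x: "y = f x" "side x = side u" "j \<in> J" "x \<in> S j"
        by (auto simp: U_def F_def)
      have jC: "j \<in> C" using x JC by blast
      have "A u j" using Au[OF jC root[OF jC]] by simp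
      then have "x \<noteq> j" using A_side x by blast
      then have "f x \<in> B x - KK" using f(3)[OF x(3), of x] x by blast
      moreover have "x \<in> T - {u}" using x uF FT by (auto simp: F_def)
      ultimately show "y \<in> W - \<Union>(\<K> c)" using x c by (auto simp: W_def KK_def)
    qed
    moreover have "trans U"
      unfolding trans_def
    proof
      fix x
      have "U \<inter> B x \<subseteq> {f x}"
      proof
        fix y assume "y \<in> U \<inter> B x"
        then obtain x' where "x' \<in> F" "y = f x'" "y \<in> B x" by (auto simp: U_def)
        then show "y \<in> {f x}" using fB[of x'] B_disj[of x' x] by blast
      qed
      then show "card (U \<inter> B x) \<le> 1" using card_mono[of "{f x}" "U \<inter> B x"] by simp
    qed
    ultimately have "2 * card {w \<in> D c. \<exists>y\<in>U. E y w} \<le> card (D c)" using \<K>(4)[OF c] by blast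
    moreover have "{w \<in> D c. \<exists>y\<in>U. E y w} = {w \<in> D c. \<exists>x\<in>F. E (f x) w}"
    proof -
      have "side x = side u" if "x \<in> F" "E (f x) w" "w \<in> D c" for x w
      proof -
        have "side x \<noteq> side c" using E_side[of "f x" x w c] fB[of x] that D[OF c] by blast
        moreover have "side u \<noteq> side c" using A_side[of u c] Au[OF c root[OF c]] by blast
        ultimately show ?thesis by blast
      qed
      then show ?thesis by (auto simp: U_def)
    qed
    moreover have "card (D c) = card {w \<in> D c. \<exists>x\<in>F. E (f x) w} + card D'"
    proof -
      have "D c = {w \<in> D c. \<exists>x\<in>F. E (f x) w} \<union> D'" by (auto simp: D'_def)
      moreover have "card ({w \<in> D c. \<exists>x\<in>F. E (f x) w} \<union> D') = card {w \<in> D c. \<exists>x\<in>F. E (f x) w} + card D'"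
        using Dfin by (intro card_Un_disjoint) (auto simp: D'_def)
      ultimately show ?thesis by simp
    qed
    ultimately have half: "card (D c) \<le> 2 * card D'" by simp
    have Sc: "card (S c) + card (insert u F) \<le> card T"
    proof -
      have "card (S c) + card (insert u F) = card (S c \<union> insert u F)"
        using cF fin[OF c] F_fin by (subst card_Un_disjoint) auto
      also have "\<dots> \<le> card T" using T_fin FT c by (intro card_mono) (auto simp: T_def)
      finally show ?thesis .
    qed
    have kC: "card C + card (S c) \<le> card T"
    proof -
      have 1: "card C = Suc (card (C - {c}))" using card.remove[OF C c] .
      have 2: "card (insert u (C - {c})) = Suc (card (C - {c}))"
        using u root C by (intro card_insert_disjoint) auto
      have 3: "insert u (C - {c}) \<inter> S c = {}"
        using u[OF c] dis[OF _ c] root by fastforce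
      have "card (insert u (C - {c}) \<union> S c) = card (insert u (C - {c})) + card (S c)"
        using C fin[OF c] 3 by (intro card_Un_disjoint) auto
      then have "card C + card (S c) = card (insert u (C - {c}) \<union> S c)"
        using 1 2 by simp
      also have "\<dots> \<le> card T" using T_fin root c by (intro card_mono) (auto simp: T_def)
      finally show ?thesis .
    qed
    have Z: "real (card (Z \<inter> B x)) \<le> 3 * real (card T - card (S c)) * \<Delta>" for x
    proof -
      have "card (Z \<inter> B x) \<le> card (KK \<inter> B x) + card (NF \<inter> B x)"
        unfolding Z_def using card_Un_le[of "KK \<inter> B x" "NF \<inter> B x"] by (simp add: Int_Un_distrib2)
      moreover have "real (card (NF \<inter> B x)) \<le> real (card (insert u F)) * \<Delta>"
      proof -
        have "card (NF \<inter> B x) \<le> card NF"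
          using F_fin V_fin by (intro card_mono) (auto simp: NF_def)
        also have "\<dots> \<le> (\<Sum>x\<in>insert u F. card {w \<in> V. E (f x) w})"
          unfolding NF_def using F_fin by (intro card_UN_le) simp
        also have "real \<dots> \<le> (\<Sum>x\<in>insert u F. \<Delta>)"
          unfolding of_nat_sum using fB B_sub deg by (intro sum_mono) blast
        finally show ?thesis by simp
      qed
      moreover have "real (card (insert u F)) * \<Delta> \<le> real (card T - card (S c)) * \<Delta>"
        using Sc \<Delta>0 by (intro mult_right_mono) auto
      moreover have "2 * real (card C) * \<Delta> \<le> 2 * real (card T - card (S c)) * \<Delta>"
        using kC \<Delta>0 by (intro mult_right_mono) auto
      ultimately show ?thesis using KK[of x] by (simp add: algebra_simps)
    qed
    have "D' \<subseteq> D c" by (auto simp: D'_def)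
    then obtain w where w: "w \<in> D'" "extends (S c) c (X \<union> Z) w"
      using contr c half Z by blast
    then obtain g where g: "g c = w" "\<And>x. x \<in> S c - {c} \<Longrightarrow> g x \<in> B x - (X \<union> Z)" "embeds (S c) g"
      unfolding extends_def by blast
    define h where "h x = (if x \<in> S c then g x else f x)" for x
    have hg: "h x = g x" if "x \<in> S c" for x using that by (simp add: h_def)
    have hf: "h x = f x" if "x \<in> insert u F" for x using that cF by (auto simp: h_def)
    have gB: "g x \<in> B x" if "x \<in> S c" for x
      using g(1) g(2)[of x] that w D[OF c] by (cases "x = c") (auto simp: D'_def)
    have cross: "E (f x) (g y) \<longleftrightarrow> A x y" if x: "x \<in> insert u F" and y: "y \<in> S c" for x y
    proof (cases "y = c")
      case True
      show ?thesis
      proof (cases "x = u")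
        case True
        have "E v w" using w D[OF c] by (auto simp: D'_def)
        then show ?thesis using True \<open>y = c\<close> f g Au[OF c root[OF c]] by simp
      next
        case False
        then have "x \<in> F" using x by simp
        then obtain j where j: "j \<in> J" "x \<in> S j" by (auto simp: F_def)
        have "\<not> A x y" using nA[of j c x y] j JC c cJ y by blast
        moreover have "\<not> E (f x) w" using w \<open>x \<in> F\<close> by (auto simp: D'_def)
        ultimately show ?thesis using True g by simp
      qed
    next
      case False
      then have gy: "g y \<in> B y - (X \<union> Z)" using g(2)[of y] y by blast
      have "\<not> E (f x) (g y)" using gy x B_sub by (auto simp: Z_def NF_def)
      moreover have "\<not> A x y"
      proof (cases "x = u")
        case True then show ?thesis using Au[OF c y] False by simp
      next
        case F: False
        then obtain j where j: "j \<in> J" "x \<in> S j" using x by (auto simp: F_def)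
        then show ?thesis using nA[of j c x y] JC c cJ y by blast
      qed
      ultimately show ?thesis by simp
    qed
    have "embeds (insert u F \<union> S c) h"
      unfolding embeds_def
    proof (intro ballI)
      fix x y assume xy: "x \<in> insert u F \<union> S c" "y \<in> insert u F \<union> S c"
      consider "x \<in> insert u F" "y \<in> insert u F" | "x \<in> S c" "y \<in> S c"
        | "x \<in> insert u F" "y \<in> S c" | "x \<in> S c" "y \<in> insert u F" using xy by blast
      then show "E (h x) (h y) \<longleftrightarrow> A x y"
      proof cases
        case 1 then show ?thesis using emb[folded F_def] by (simp only: embeds_def hf)
      next
        case 2 then show ?thesis using g(3) hg by (simp add: embeds_def)
      next
        case 3 then show ?thesis using cross[of x y] hf hg by simp
      next
        case 4
        then show ?thesis using cross[of y x] hf hg E_sym A_sym by metis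
      qed
    qed
    moreover have "insert u F \<union> S c = insert u (\<Union>c\<in>insert c J. S c)" by (auto simp: F_def)
    moreover have "h u = v" using hf f by simp
    moreover have "h j \<in> D j" if "j \<in> insert c J" for j
    proof (cases "j = c")
      case True then show ?thesis using hg[OF root[OF c]] g w by (simp add: D'_def)
    next
      case False
      then have "j \<in> F" using that root JC by (auto simp: F_def)
      then show ?thesis using hf f that False by simp
    qed
    moreover have "h x \<in> B x - X - KK - {w. E v w}" if "j \<in> insert c J" "x \<in> S j - {j}" for j x
    proof (cases "j = c")
      case True
      then have x: "x \<in> S c - {c}" using that by simp
      have "\<not> E v (g x)" using cross[of u x] x Au[OF c, of x] f by auto
      then show ?thesis using hg[of x] x g(2)[OF x] by (auto simp: Z_def)
    next
      case False
      then have "x \<in> F" using that by (auto simp: F_def)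
      then show ?thesis using hf f(3)[of j x] that False by simp
    qed
    ultimately show ?case by (intro exI[of _ h]) auto
  qed
  obtain f where f: "f u = v" "\<And>c. c \<in> C \<Longrightarrow> f c \<in> D c"
    "\<And>c x. c \<in> C \<Longrightarrow> x \<in> S c - {c} \<Longrightarrow> f x \<in> B x - X - KK - {w. E v w}"
    and emb: "embeds T f" using greedy[OF C subset_refl] unfolding T_def by blast
  have "f x \<in> B x - X" if x: "x \<in> T - {u}" for x
  proof -
    obtain c where c: "c \<in> C" "x \<in> S c" using x by (auto simp: T_def)
    show ?thesis
    proof (cases "x = c")
      case True then show ?thesis using f(2)[OF c(1)] D[OF c(1)] by blast
    next
      case False then show ?thesis using f(3)[OF c(1), of x] c by blast
    qed
  qed
  then have "extends T u X v" using f emb unfolding extends_def by blast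
  then show False using no by simp
qed

end


context blocks begin

text \<open>
  The hypothesis \<open>rob\<close> is robustness, with threshold \<open>q d\<close> at depth \<open>d\<close>; \<open>a d\<close> is the number of
  candidates for the root that suffices at depth \<open>d\<close>. The bound on \<open>X\<close> is the budget of forbidden
  vertices: descending from \<open>u\<close> to a child \<open>c\<close> allows \<open>3 \<Delta> + \<gamma>\<close> more of them for each vertex that
  is in the subtree of \<open>u\<close> but not in that of \<open>c\<close>. Here \<open>3 \<Delta>\<close> pays for the last blocked vertex,
  and \<open>\<gamma>\<close> for all previous ones.
\<close>

lemma rooted_copy:
  fixes a q :: "nat \<Rightarrow> real" and t r :: nat and \<gamma> \<rho> b :: real
  assumes tree: "rooted_tree A r d u S"
    and St: "card S \<le> t"
    and b: "\<And>x. x \<in> S \<Longrightarrow> b \<le> real (card (B x))"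
    and rob: "\<And>d x y D C. d < r \<Longrightarrow> A x y \<Longrightarrow> D \<subseteq> B x \<Longrightarrow> C \<subseteq> B y \<Longrightarrow>
      a d / real t \<le> real (card D) \<Longrightarrow> \<rho> \<le> real (card C) \<Longrightarrow> \<exists>v\<in>D. q d \<le> real (card {w \<in> C. E v w})"
    and pos: "\<And>d. 0 < a d" "\<And>d. 0 < q d" "0 \<le> \<Delta>" "0 \<le> \<gamma>"
    and \<gamma>: "\<And>d. d < r \<Longrightarrow> 6 * (real t - 1) * \<Delta> * a (Suc d) / q d \<le> \<gamma>"
    and budget: "\<And>d. d < r \<Longrightarrow> 3 * \<Delta> * (real t - 2) + \<gamma> * (real t - 1) + a (Suc d) + \<rho> \<le> b"
    and D: "D \<subseteq> B u" "a d \<le> real (card D)"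
    and X: "\<And>x. real (card (X \<inter> B x)) \<le> (3 * \<Delta> + \<gamma>) * (real t - real (card S))"
  shows "\<exists>v\<in>D. extends S u X v"
  using tree St b D X
proof (induction arbitrary: D X rule: rooted_tree.induct)
  case (node C d S u)
  define T where "T = insert u (\<Union>c\<in>C. S c)"
  note St = node.prems(1)[folded T_def]
  note b = node.prems(2)[folded T_def]
  note D = node.prems(3,4)
  note X = node.prems(5)[folded T_def]
  have C: "finite C" by fact
  have sub: "rooted_tree A r (Suc d) c (S c)" if "c \<in> C" for c using node.hyps that by blast
  have root: "c \<in> S c" and fin: "finite (S c)" if "c \<in> C" for c
    using sub[OF that] rooted_tree_root rooted_tree_finite by metis+
  have u: "u \<notin> S c" if "c \<in> C" for c using node.hyps that by blast
  have dis: "S c \<inter> S c' = {}" if "c \<in> C" "c' \<in> C" "c \<noteq> c'" for c c' using node.hyps that by blast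
  have Au: "A u x \<longleftrightarrow> x = c" if "c \<in> C" "x \<in> S c" for c x using node.hyps that by blast
  have T_fin: "finite T" using C fin by (auto simp: T_def)
  have CT: "card C + 1 \<le> card T"
  proof -
    have "card (insert u C) = Suc (card C)" using C u root by (intro card_insert_disjoint) auto
    moreover have "card (insert u C) \<le> card T" using root T_fin by (intro card_mono) (auto simp: T_def)
    ultimately show ?thesis by simp
  qed
  have t1: "1 \<le> t" using CT St by simp
  have D_fin: "finite D" using D B_fin finite_subset by blast
  show ?case
  proof (rule ccontr)
    assume "\<not> ?case"
    then have no: "\<not> extends T u X v" if "v \<in> D" for v using that by (auto simp: T_def)
    have C_ne: "C \<noteq> {}"
    proof
      assume "C = {}"
      have "D \<noteq> {}" using D(2) pos(1)[of d] by auto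
      then obtain v where v: "v \<in> D" by blast
      then have "extends T u X v" using \<open>C = {}\<close> D(1) E_no_loop no_loop
        unfolding extends_def by (intro exI[of _ "\<lambda>_. v"]) (auto simp: embeds_def T_def)
      then show False using no v by simp
    qed
    then have d: "d < r" using node.hyps by blast
    have "1 \<le> card C" using C C_ne by (simp add: Suc_le_eq card_gt_0_iff)
    then have T2: "2 \<le> card T" using CT by linarith
    \<comment> \<open>the state after collecting \<open>n\<close> blocked vertices: \<open>X'\<close> is forbidden, and \<open>Y c\<close> contains the
      useless neighbours found in the block of \<open>c\<close>, each step contributing at least \<open>q d / 2\<close>\<close>
    define Q where "Q n X' Y \<longleftrightarrow> X \<subseteq> X' \<and>
      (\<forall>x. real (card (X' \<inter> B x)) \<le>
        (3 * \<Delta> + \<gamma>) * (real t - real (card T)) + real n * (3 * (real t - 1) * \<Delta>)) \<and>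
      (\<forall>c\<in>C. Y c \<subseteq> B c \<and> real (card (Y c)) < a (Suc d) \<and> (\<forall>y\<in>Y c. \<not> extends (S c) c X' y)) \<and>
      real n * q d / 2 \<le> (\<Sum>c\<in>C. real (card (Y c)))" for n :: nat and X' Y
    define P where "P n \<longleftrightarrow> (\<exists>X' Y. Q n X' Y)" for n
    have "Q 0 X (\<lambda>_. {})" unfolding Q_def using X pos by auto
    then have "P 0" unfolding P_def by blast
    have bound: "real n \<le> 2 * real (card C) * a (Suc d) / q d" if "P n" for n
    proof -
      obtain X' Y where "Q n X' Y" using \<open>P n\<close> unfolding P_def by blast
      then have *: "\<And>c. c \<in> C \<Longrightarrow> real (card (Y c)) < a (Suc d)"
        "real n * q d / 2 \<le> (\<Sum>c\<in>C. real (card (Y c)))"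
        by (simp_all add: Q_def)
      have "(\<Sum>c\<in>C. real (card (Y c))) \<le> (\<Sum>c\<in>C. a (Suc d))"
        using * by (intro sum_mono) (simp add: less_imp_le)
      then show ?thesis using * pos(2)[of d] by (simp add: field_simps)
    qed
    have ub: "n \<le> nat \<lceil>2 * real (card C) * a (Suc d) / q d\<rceil>" if "P n" for n
      using bound[OF that] by linarith
    obtain n where n: "P n" and max: "\<And>m. P m \<Longrightarrow> m \<le> n"
      using GreatestI_nat[of P, OF \<open>P 0\<close> ub] Greatest_le_nat[of P, OF _ ub] by blast
    have extra: "real n * (3 * (real t - 1) * \<Delta>) \<le> \<gamma> * real (card C)"
    proof -
      have "real n * (3 * (real t - 1) * \<Delta>) \<le>
          (2 * real (card C) * a (Suc d) / q d) * (3 * (real t - 1) * \<Delta>)"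
        using bound[OF n] t1 pos by (intro mult_right_mono) auto
      also have "\<dots> = (6 * (real t - 1) * \<Delta> * a (Suc d) / q d) * real (card C)" by simp
      also have "\<dots> \<le> \<gamma> * real (card C)" using \<gamma>[OF d] by (intro mult_right_mono) auto
      finally show ?thesis .
    qed
    obtain X' Y where "Q n X' Y" using n unfolding P_def by blast
    then have XX': "X \<subseteq> X'"
      and X': "\<And>x. real (card (X' \<inter> B x)) \<le>
        (3 * \<Delta> + \<gamma>) * (real t - real (card T)) + real n * (3 * (real t - 1) * \<Delta>)"
      and Y: "\<And>c. c \<in> C \<Longrightarrow> Y c \<subseteq> B c" "\<And>c. c \<in> C \<Longrightarrow> real (card (Y c)) < a (Suc d)"
        "\<And>c y. c \<in> C \<Longrightarrow> y \<in> Y c \<Longrightarrow> \<not> extends (S c) c X' y"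
      and Ysum: "real n * q d / 2 \<le> (\<Sum>c\<in>C. real (card (Y c)))"
      by (simp_all add: Q_def)
    define R where "R c = B c - X' - Y c" for c
    have R: "\<rho> \<le> real (card (R c))" if c: "c \<in> C" for c
    proof -
      have cT: "c \<in> T" using root c by (auto simp: T_def)
      have "card (B c) \<le> card (R c \<union> ((X' \<inter> B c) \<union> Y c))"
        using B_fin[of c] Y(1)[OF c] by (intro card_mono) (auto simp: R_def intro: finite_subset)
      also have "\<dots> \<le> card (R c) + (card (X' \<inter> B c) + card (Y c))"
        by (meson add_left_mono card_Un_le order_trans)
      finally have 1: "real (card (B c)) \<le> real (card (R c)) + real (card (X' \<inter> B c)) + real (card (Y c))"
        by linarith
      have "(3 * \<Delta> + \<gamma>) * (real t - real (card T)) + \<gamma> * real (card C) \<le>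
          3 * \<Delta> * (real t - 2) + \<gamma> * (real t - 1)"
      proof -
        have "3 * \<Delta> * (real t - real (card T)) \<le> 3 * \<Delta> * (real t - 2)"
          using T2 pos by (intro mult_left_mono) auto
        moreover have "\<gamma> * (real t - real (card T) + real (card C)) \<le> \<gamma> * (real t - 1)"
          using CT pos by (intro mult_left_mono) auto
        ultimately show ?thesis by (simp add: algebra_simps)
      qed
      then show ?thesis using 1 b[OF cT] budget[OF d] X'[of c] extra Y(2)[OF c] by linarith
    qed
    \<comment> \<open>For each child, fewer than \<open>a d / t\<close> vertices of \<open>D\<close> have few neighbours in \<open>R c\<close>, and there
      are fewer than \<open>t\<close> children.\<close>
    have "\<exists>v\<in>D. \<forall>c\<in>C. q d \<le> real (card {w \<in> R c. E v w})"
    proof (rule ccontr)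
      assume contr: "\<not> ?thesis"
      define L where "L c = {v \<in> D. \<not> q d \<le> real (card {w \<in> R c. E v w})}" for c
      have L: "real (card (L c)) < a d / real t" if c: "c \<in> C" for c
      proof (rule ccontr)
        assume "\<not> ?thesis"
        then have "\<exists>v\<in>L c. q d \<le> real (card {w \<in> R c. E v w})"
          using D(1) R[OF c] Au[OF c root[OF c]] by (intro rob[OF d, of u c]) (auto simp: L_def R_def)
        then show False by (auto simp: L_def)
      qed
      have "D \<subseteq> (\<Union>c\<in>C. L c)" using contr by (auto simp: L_def)
      then have "card D \<le> card (\<Union>c\<in>C. L c)" using C D_fin by (intro card_mono) (auto simp: L_def)
      also have "\<dots> \<le> (\<Sum>c\<in>C. card (L c))" using C by (rule card_UN_le)
      also have "real \<dots> \<le> (\<Sum>c\<in>C. a d / real t)"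
        unfolding of_nat_sum using L by (intro sum_mono) (simp add: less_imp_le)
      also have "\<dots> = a d * (real (card C) / real t)" by simp
      also have "\<dots> < a d * 1"
        using CT St t1 pos(1)[of d] by (intro mult_strict_left_mono) auto
      finally show False using D(2) by simp
    qed
    then obtain v where v: "v \<in> D" "\<And>c. c \<in> C \<Longrightarrow> q d \<le> real (card {w \<in> R c. E v w})" by blast
    have vB: "v \<in> B u" using v D by blast
    have "\<exists>c\<in>C. \<exists>D' Z. D' \<subseteq> {w \<in> R c. E v w} \<and> card {w \<in> R c. E v w} \<le> 2 * card D' \<and>
      (\<forall>x. real (card (Z \<inter> B x)) \<le> 3 * real (card (insert u (\<Union>c\<in>C. S c)) - card (S c)) * \<Delta>) \<and>
      (\<forall>w\<in>D'. \<not> extends (S c) c (X' \<union> Z) w)"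
    proof (rule copy_or_blocked_child[OF C])
      show "\<not> extends (insert u (\<Union>c\<in>C. S c)) u X' v"
        using no[OF v(1)] extends_mono[OF _ XX'] by (auto simp: T_def)
      show "{w \<in> R c. E v w} \<noteq> {}" if "c \<in> C" for c
        using v(2)[OF that] pos(2)[of d] by (metis card.empty not_le of_nat_0)
      show "\<not> A x y" if "c \<in> C" "c' \<in> C" "c \<noteq> c'" "x \<in> S c" "y \<in> S c'" for c c' x y
        using node.hyps that by blast
    qed (use fin root u dis Au vB in \<open>auto simp: R_def\<close>)
    then obtain c D' Z where c: "c \<in> C" and D': "D' \<subseteq> {w \<in> R c. E v w}"
      and D'_card: "card {w \<in> R c. E v w} \<le> 2 * card D'"
      and Z: "\<And>x. real (card (Z \<inter> B x)) \<le> 3 * real (card T - card (S c)) * \<Delta>"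
      and D'_no: "\<And>w. w \<in> D' \<Longrightarrow> \<not> extends (S c) c (X' \<union> Z) w"
      unfolding T_def[symmetric] by blast
    have Sc: "card C + card (S c) \<le> card T"
    proof -
      have "card (insert u (C - {c}) \<union> S c) = card (insert u (C - {c})) + card (S c)"
        using C fin[OF c] u[OF c] dis[OF _ c] root by (intro card_Un_disjoint) fastforce+
      moreover have "card (insert u (C - {c})) = Suc (card (C - {c}))"
        using u root C by (intro card_insert_disjoint) auto
      moreover have "card C = Suc (card (C - {c}))" using card.remove[OF C c] .
      moreover have "card (insert u (C - {c}) \<union> S c) \<le> card T"
        using T_fin root c by (intro card_mono) (auto simp: T_def)
      ultimately show ?thesis by simp
    qed
    have X'Z: "real (card ((X' \<union> Z) \<inter> B x)) \<le> real (card (X' \<inter> B x)) + real (card (Z \<inter> B x))" for x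
      using card_Un_le[of "X' \<inter> B x" "Z \<inter> B x"] by (simp add: Int_Un_distrib2 flip: of_nat_add)
    have D'B: "D' \<subseteq> B c" and D'Y: "Y c \<inter> D' = {}" using D' by (auto simp: R_def)
    have new: "\<not> extends (S c) c (X' \<union> Z) y" if "y \<in> Y c \<union> D'" for y
      using that D'_no Y(3)[OF c] extends_mono[of _ _ "X' \<union> Z" _ X'] by blast
    have card_new: "card (Y c \<union> D') = card (Y c) + card D'"
      using D'B D'Y Y(1)[OF c] B_fin[of c] by (intro card_Un_disjoint) (auto intro: finite_subset)
    \<comment> \<open>by maximality of \<open>n\<close>\<close>
    have "a (Suc d) \<le> real (card (Y c \<union> D'))"
    proof (rule ccontr)
      assume small: "\<not> ?thesis"
      have "Q (Suc n) (X' \<union> Z) (Y(c := Y c \<union> D'))"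
        unfolding Q_def
      proof (intro conjI allI ballI)
        show "X \<subseteq> X' \<union> Z" using XX' by blast
        fix x
        have "S c \<noteq> {}" using root[OF c] by blast
        then have "1 \<le> card (S c)" using fin[OF c] by (simp add: Suc_le_eq card_gt_0_iff)
        then have "real (card T - card (S c)) \<le> real t - 1" using St Sc by linarith
        then have "3 * real (card T - card (S c)) * \<Delta> \<le> 3 * (real t - 1) * \<Delta>"
          using pos by (intro mult_right_mono) auto
        then show "real (card ((X' \<union> Z) \<inter> B x)) \<le>
          (3 * \<Delta> + \<gamma>) * (real t - real (card T)) + real (Suc n) * (3 * (real t - 1) * \<Delta>)"
          using X'Z[of x] X'[of x] Z[of x] by (simp add: algebra_simps)
      next
        fix j assume j: "j \<in> C"
        show "(Y(c := Y c \<union> D')) j \<subseteq> B j" using Y(1)[OF j] D'B by auto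
        show "real (card ((Y(c := Y c \<union> D')) j)) < a (Suc d)" using Y(2)[OF j] small by auto
        fix y assume y: "y \<in> (Y(c := Y c \<union> D')) j"
        show "\<not> extends (S j) j (X' \<union> Z) y"
        proof (cases "j = c")
          case True
          then show ?thesis using new[of y] y by simp
        next
          case False
          then have "\<not> extends (S j) j X' y" using Y(3)[OF j, of y] y by simp
          then show ?thesis using extends_mono[of "S j" j "X' \<union> Z" y X'] by blast
        qed
      next
        have "(\<Sum>j\<in>C. real (card ((Y(c := Y c \<union> D')) j))) =
            real (card (Y c \<union> D')) + (\<Sum>j\<in>C - {c}. real (card (Y j)))"
          using C c by (subst sum.remove[of _ c]) (auto intro!: sum.cong)
        also have "\<dots> = (\<Sum>j\<in>C. real (card (Y j))) + real (card D')"
          using C c by (subst (2) sum.remove[of _ c]) (auto simp: card_new)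
        finally show "real (Suc n) * q d / 2 \<le> (\<Sum>j\<in>C. real (card ((Y(c := Y c \<union> D')) j)))"
          using Ysum v(2)[OF c] D'_card by (simp add: field_simps)
      qed
      then have "P (Suc n)" unfolding P_def by blast
      then show False using max[of "Suc n"] by simp
    qed
    moreover have "real (card ((X' \<union> Z) \<inter> B x)) \<le> (3 * \<Delta> + \<gamma>) * (real t - real (card (S c)))" for x
    proof -
      have le: "card (S c) \<le> card T" using Sc by simp
      have "\<gamma> * real (card C) \<le> \<gamma> * (real (card T) - real (card (S c)))"
        using Sc pos by (intro mult_left_mono) auto
      then show ?thesis
        using X'Z[of x] X'[of x] Z[of x] extra le by (simp add: of_nat_diff algebra_simps)
    qed
    moreover have "card (S c) \<le> t" using Sc St by simp
    moreover have "b \<le> real (card (B x))" if "x \<in> S c" for x using b[of x] that c by (auto simp: T_def)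
    ultimately have "\<exists>v\<in>Y c \<union> D'. extends (S c) c (X' \<union> Z) v"
      using node.IH[OF c] Y(1)[OF c] D'B by blast
    then show False using new by blast
  qed
qed

end


section \<open>Rooting an undirected tree at a centre\<close>

text \<open>
  The subtree below \<open>u\<close> consists of the vertices that reach \<open>u\<close> by iterating the parent function.
\<close>

lemma rooted_tree_of_layers:
  fixes A :: "'a \<Rightarrow> 'a \<Rightarrow> bool" and V :: "'a set" and dep :: "'a \<Rightarrow> nat"
  assumes V: "finite V" "\<rho> \<in> V" "\<And>x y. A x y \<Longrightarrow> x \<in> V"
    and sym: "\<And>x y. A x y \<Longrightarrow> A y x"
    and layers: "\<And>x y. A x y \<Longrightarrow> dep x = Suc (dep y) \<or> dep y = Suc (dep x)"
    and dep: "\<And>x. x \<in> V \<Longrightarrow> dep x \<le> r" "\<And>x. x \<in> V \<Longrightarrow> dep x = 0 \<longleftrightarrow> x = \<rho>"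
    and parent: "\<And>x. x \<in> V \<Longrightarrow> x \<noteq> \<rho> \<Longrightarrow> \<exists>y. A x y \<and> dep x = Suc (dep y)"
    and unique: "\<And>x y y'. A x y \<Longrightarrow> A x y' \<Longrightarrow> dep x = Suc (dep y) \<Longrightarrow> dep x = Suc (dep y') \<Longrightarrow> y = y'"
  shows "rooted_tree A r 0 \<rho> V"
proof -
  define par where "par x = (THE y. A x y \<and> dep x = Suc (dep y))" for x
  have par_eq: "par x = y" if "A x y" "dep x = Suc (dep y)" for x y
    unfolding par_def using that unique[of x] by (intro the_equality) auto
  have par: "A x (par x)" "dep x = Suc (dep (par x))" if x: "x \<in> V" "dep x \<noteq> 0" for x
  proof -
    have "x \<noteq> \<rho>" using x dep(2)[of x] by simp
    then obtain y where "A x y" "dep x = Suc (dep y)" using parent x by blast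
    then show "A x (par x)" "dep x = Suc (dep (par x))" using par_eq by auto
  qed
  have anc: "(par ^^ k) x \<in> V \<and> dep ((par ^^ k) x) = dep x - k" if "x \<in> V" "k \<le> dep x" for x k
    using that(2)
  proof (induction k)
    case 0
    then show ?case using that by simp
  next
    case (Suc k)
    then have *: "(par ^^ k) x \<in> V" "dep ((par ^^ k) x) = dep x - k" by auto
    then have "dep ((par ^^ k) x) \<noteq> 0" using Suc by simp
    from par[OF *(1) this] show ?case using * V(3) sym by auto
  qed
  define desc where "desc u = {x \<in> V. dep u \<le> dep x \<and> (par ^^ (dep x - dep u)) x = u}" for u
  have desc_self: "u \<in> desc u" if "u \<in> V" for u using that by (simp add: desc_def)
  have desc_unique: "c = c'" if "x \<in> desc c" "x \<in> desc c'" "dep c = dep c'" for x c c'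
    using that by (simp add: desc_def)
  have main: "rooted_tree A r (dep u) u (desc u)" if "u \<in> V" for u
    using that
  proof (induction "r - dep u" arbitrary: u rule: less_induct)
    case less
    define C where "C = {c. A u c \<and> dep c = Suc (dep u)}"
    have CV: "C \<subseteq> V" using sym V(3) by (auto simp: C_def)
    have par_C: "par c = u" if "c \<in> C" for c using that sym par_eq by (auto simp: C_def)
    have dC: "dep c = Suc (dep u)" if "c \<in> C" for c using that by (simp add: C_def)
    have desc_u: "desc u = insert u (\<Union>c\<in>C. desc c)"
    proof (intro equalityI subsetI)
      fix x assume x: "x \<in> desc u"
      show "x \<in> insert u (\<Union>c\<in>C. desc c)"
      proof (cases "dep x = dep u")
        case True then show ?thesis using x by (simp add: desc_def)
      next
        case False
        define k where "k = dep x - Suc (dep u)"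
        have k: "dep x - dep u = Suc k" "k \<le> dep x" "x \<in> V" using x False by (auto simp: desc_def k_def)
        define c where "c = (par ^^ k) x"
        have c: "c \<in> V" "dep c = Suc (dep u)" using anc[OF k(3,2)] k by (auto simp: c_def)
        have "par c = u" using x k by (simp add: desc_def c_def)
        then have "A c u" using par[of c] c by simp
        then have "c \<in> C" using sym c by (simp add: C_def)
        moreover have "x \<in> desc c" using x k c by (auto simp: desc_def c_def k_def)
        ultimately show ?thesis by blast
      qed
    next
      fix x assume x: "x \<in> insert u (\<Union>c\<in>C. desc c)"
      show "x \<in> desc u"
      proof (cases "x = u")
        case True then show ?thesis using desc_self less.prems by simp
      next
        case False
        then obtain c where c: "c \<in> C" "x \<in> desc c" using x by blast
        have "dep x - dep u = Suc (dep x - dep c)" using c dC by (auto simp: desc_def)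
        then show ?thesis using c dC par_C by (auto simp: desc_def)
      qed
    qed
    show ?case
      unfolding desc_u
    proof (rule rooted_tree.node)
      show "finite C" using CV V(1) finite_subset by blast
      show "dep u < r" if "C \<noteq> {}" using that dC CV dep(1) by fastforce
      show "rooted_tree A r (Suc (dep u)) c (desc c)" if c: "c \<in> C" for c
      proof -
        have "c \<in> V" using c CV by blast
        then show ?thesis using less.hyps[of c] dC[OF c] dep(1)[of c] by simp
      qed
      show "u \<notin> desc c" if "c \<in> C" for c using dC[OF that] by (simp add: desc_def)
      show "desc c \<inter> desc c' = {}" if "c \<in> C" "c' \<in> C" "c \<noteq> c'" for c c'
        using desc_unique[of _ c c'] that dC by auto
      show "A u x \<longleftrightarrow> x = c" if "c \<in> C" "x \<in> desc c" for c x
      proof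
        assume "A u x"
        then have "dep x = dep c" using layers[of u x] that dC by (auto simp: desc_def)
        then show "x = c" using that by (simp add: desc_def)
      qed (use that in \<open>simp add: C_def\<close>)
      have no: "\<not> (A x y \<and> dep x = Suc (dep y))"
        if "c \<in> C" "c' \<in> C" "c \<noteq> c'" "x \<in> desc c" "y \<in> desc c'" for c c' x y
      proof
        assume xy: "A x y \<and> dep x = Suc (dep y)"
        then have "par x = y" using par_eq by blast
        have d: "dep c = dep c'" using that dC by simp
        have "dep x - dep c = Suc (dep y - dep c)" using xy that d by (auto simp: desc_def)
        moreover have "(par ^^ (dep x - dep c)) x = c" using that by (simp add: desc_def)
        ultimately have "(par ^^ (dep y - dep c)) y = c"
          using \<open>par x = y\<close> by (simp add: funpow_Suc_right del: funpow.simps)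
        then have "y \<in> desc c" using that d by (simp add: desc_def)
        then show False using desc_unique[of y c c'] that d by blast
      qed
      show "\<not> A x y" if "c \<in> C" "c' \<in> C" "c \<noteq> c'" "x \<in> desc c" "y \<in> desc c'" for c c' x y
        using no[of c c' x y] no[of c' c y x] layers[of x y] sym[of x y] that by blast
    qed
  qed
  have dr: "dep \<rho> = 0" using dep(2)[of \<rho>] V(2) by simp
  have "desc \<rho> = V"
  proof -
    have "(par ^^ dep x) x = \<rho>" if "x \<in> V" for x
      using anc[OF that order_refl] dep(2)[of "(par ^^ dep x) x"] by simp
    then show ?thesis using dr by (auto simp: desc_def)
  qed
  then show ?thesis using main[OF V(2)] dr by simp
qed

text \<open>
  The layers are given by the distance \<open>dep\<close> to a centre. Adjacent vertices lie in different
  layers by parity, as the graph is bipartite. If \<open>x\<close> had two neighbours in the layer before it,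
  these would be joined through the centre by a path avoiding \<open>x\<close>, and \<open>x\<close> would close it to a
  cycle.
\<close>

lemma undirected_tree_rooted:
  fixes T :: "'a pair_pre_digraph" and side :: "'a \<Rightarrow> bool"
  assumes tree: "undirected_tree T"
    and side: "\<And>x y. (x, y) \<in> parcs T \<Longrightarrow> side x \<noteq> side y"
  shows "\<exists>\<rho>\<in>pverts T. rooted_tree (\<lambda>x y. (x, y) \<in> parcs T) (radius T) 0 \<rho> (pverts T)"
proof -
  interpret pair_graph T using tree by (simp add: undirected_tree_def)
  have conn: "connected (with_proj T)" and acyc: "\<And>p. cycle p \<Longrightarrow> length p < 3"
    using tree by (auto simp: undirected_tree_def not_le)
  have sc: "strongly_connected (with_proj T)"
    using symmetric_connected_imp_strongly_connected[OF sym_arcs conn] .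
  then have ne: "pverts T \<noteq> {}" by (simp add: strongly_connected_def)
  have reach: "\<exists>p. apath u p v" if "u \<in> pverts T" "v \<in> pverts T" for u v
    using sc that reachable_apath by (auto simp: strongly_connected_def)
  have "\<exists>r. \<exists>v\<in>pverts T. \<forall>u\<in>pverts T. \<exists>p. apath u p v \<and> length p \<le> r"
  proof -
    obtain v where v: "v \<in> pverts T" using ne by blast
    have "\<forall>u\<in>pverts T. \<exists>p. apath u p v \<and> length p \<le> card (pverts T)"
      using reach[OF _ v] length_apath by fastforce
    then show ?thesis using v by blast
  qed
  then have "\<exists>v\<in>pverts T. \<forall>u\<in>pverts T. \<exists>p. apath u p v \<and> length p \<le> radius T"
    unfolding radius_def by (rule LeastI_ex)
  then obtain \<rho> where \<rho>: "\<rho> \<in> pverts T"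
    and rad: "\<And>u. u \<in> pverts T \<Longrightarrow> \<exists>p. awalk u p \<rho> \<and> length p \<le> radius T"
    using awalkI_apath by blast
  define dep where "dep u = (LEAST k. \<exists>p. awalk u p \<rho> \<and> length p = k)" for u
  have dep_le: "dep u \<le> length p" if "awalk u p \<rho>" for u p
    unfolding dep_def using that by (intro Least_le) blast
  have dep_walk: "\<exists>p. awalk u p \<rho> \<and> length p = dep u" if "u \<in> pverts T" for u
    unfolding dep_def using rad[OF that] LeastI_ex[of "\<lambda>k. \<exists>p. awalk u p \<rho> \<and> length p = k"] by blast
  have parity: "(side u = side v) = even (length p)" if "awalk u p v" for u p v
    using that
  proof (induction p arbitrary: u)
    case Nil then show ?case by (simp add: awalk_Nil_iff)
  next
    case (Cons e p)
    then have "e \<in> parcs T" "u = fst e" "awalk (snd e) p v" by (auto simp: awalk_Cons_iff)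
    then show ?case using Cons.IH side[of "fst e" "snd e"] by auto
  qed
  have arc_dep: "dep x \<le> Suc (dep y)" if "(x, y) \<in> parcs T" for x y
  proof -
    have "y \<in> pverts T" using that in_arcsD2 by blast
    then obtain p where p: "awalk y p \<rho>" "length p = dep y" using dep_walk by blast
    then have "awalk x ((x, y) # p) \<rho>" using that in_arcsD1 by (simp add: awalk_Cons_iff)
    from dep_le[OF this] show ?thesis using p by simp
  qed
  have layers: "dep x = Suc (dep y) \<or> dep y = Suc (dep x)" if xy: "(x, y) \<in> parcs T" for x y
  proof -
    have yx: "(y, x) \<in> parcs T" using xy arcs_symmetric by blast
    have V: "x \<in> pverts T" "y \<in> pverts T" using xy in_arcsD1 in_arcsD2 by blast+
    have "dep x \<noteq> dep y"
    proof
      assume eq: "dep x = dep y"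
      obtain p q where "awalk x p \<rho>" "length p = dep x" "awalk y q \<rho>" "length q = dep y"
        using dep_walk V by metis
      then show False using parity[of x p \<rho>] parity[of y q \<rho>] eq side[OF xy] by auto
    qed
    then show ?thesis using arc_dep[OF xy] arc_dep[OF yx] by linarith
  qed
  have dep0: "dep x = 0 \<longleftrightarrow> x = \<rho>" if x: "x \<in> pverts T" for x
  proof
    assume "dep x = 0"
    then show "x = \<rho>" using dep_walk[OF x] by (auto simp: awalk_Nil_iff)
  next
    assume "x = \<rho>"
    then have "awalk x [] \<rho>" using x by (simp add: awalk_Nil_iff)
    from dep_le[OF this] show "dep x = 0" by simp
  qed
  have parent: "\<exists>y. (x, y) \<in> parcs T \<and> dep x = Suc (dep y)" if x: "x \<in> pverts T" "x \<noteq> \<rho>" for x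
  proof -
    obtain p where p: "awalk x p \<rho>" "length p = dep x" using dep_walk x by blast
    have "p \<noteq> []" using p x by (auto simp: awalk_Nil_iff)
    then obtain e p' where e: "p = e # p'" by (cases p) auto
    then have 1: "(x, snd e) \<in> parcs T" "awalk (snd e) p' \<rho>"
      using p by (auto simp: awalk_Cons_iff)
    have "Suc (dep (snd e)) \<le> dep x" using dep_le[OF 1(2)] p e by simp
    then show ?thesis using 1 arc_dep[OF 1(1)] by (intro exI[of _ "snd e"]) auto
  qed
  have down: "\<exists>p. awalk x p \<rho> \<and> (\<forall>e\<in>set p. dep (fst e) \<le> dep x \<and> dep (snd e) \<le> dep x)"
    if "x \<in> pverts T" for x
    using that
  proof (induction "dep x" arbitrary: x)
    case 0
    then show ?case using dep0 by (intro exI[of _ "[]"]) (simp add: awalk_Nil_iff)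
  next
    case (Suc d)
    then have "x \<noteq> \<rho>" using dep0 by fastforce
    then obtain y where y: "(x, y) \<in> parcs T" "dep x = Suc (dep y)" using parent Suc by blast
    then have "d = dep y" "y \<in> pverts T" using Suc(2) in_arcsD2 by auto
    then obtain p where p: "awalk y p \<rho>" "\<forall>e\<in>set p. dep (fst e) \<le> dep y \<and> dep (snd e) \<le> dep y"
      using Suc(1) by blast
    then show ?case using y Suc.prems
      by (intro exI[of _ "(x, y) # p"]) (auto simp: awalk_Cons_iff intro: le_SucI)
  qed
  have unique: "y = y'"
    if xy: "(x, y) \<in> parcs T" "(x, y') \<in> parcs T" "dep x = Suc (dep y)" "dep x = Suc (dep y')" for x y y'
  proof (rule ccontr)
    assume "y \<noteq> y'"
    have V: "y \<in> pverts T" "y' \<in> pverts T" "x \<in> pverts T" using xy in_arcsD1 in_arcsD2 by blast+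
    obtain p where p: "awalk y p \<rho>" "\<And>e. e \<in> set p \<Longrightarrow> dep (fst e) \<le> dep y \<and> dep (snd e) \<le> dep y"
      using down[OF V(1)] by blast
    obtain p' where p': "awalk y' p' \<rho>"
      "\<And>e. e \<in> set p' \<Longrightarrow> dep (fst e) \<le> dep y' \<and> dep (snd e) \<le> dep y'"
      using down[OF V(2)] by blast
    have rev: "set (rev_path q) = (\<lambda>e. (snd e, fst e)) ` set q" for q :: "('a \<times> 'a) list"
      by (induction q) auto
    define w where "w = p @ rev_path p'"
    have w: "awalk y w y'" using p p' by (auto simp: w_def)
    have w_dep: "dep (fst e) < dep x \<and> dep (snd e) < dep x" if "e \<in> set w" for e
      using that p(2) p'(2) xy by (fastforce simp: w_def rev)
    define a where "a = awalk_to_apath w"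
    have a: "apath y a y'" using apath_awalk_to_apath[OF w] by (simp add: a_def)
    have aw: "awalk y a y'" using a awalkI_apath by blast
    have "set a \<subseteq> set w" using awalk_to_apath_subset[OF w] by (simp add: a_def)
    then have "dep z < dep x" if "z \<in> set (awalk_verts y a)" for z
      using that w_dep xy set_awalk_verts[OF aw] by auto
    then have x: "x \<notin> set (awalk_verts y a)" by blast
    have "a \<noteq> []" using aw \<open>y \<noteq> y'\<close> by (auto simp: awalk_Nil_iff)
    have y'x: "(y', x) \<in> parcs T" using xy arcs_symmetric by blast
    have last: "awalk y' [(y', x)] x" using y'x V by (simp add: awalk_Cons_iff awalk_Nil_iff)
    have full: "awalk y (a @ [(y', x)]) x" by (rule awalk_appendI[OF aw last])
    have "awalk x ((x, y) # a @ [(y', x)]) x"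
      using full xy V by (simp add: awalk_Cons_iff del: awalk_append_iff)
    moreover have "awalk_verts y (a @ [(y', x)]) = awalk_verts y a @ [x]"
      using awalk_verts_append[OF full] by simp
    then have "distinct (tl (awalk_verts x ((x, y) # a @ [(y', x)])))"
      using a x by (simp add: apath_def)
    ultimately have "cycle ((x, y) # a @ [(y', x)])" unfolding cycle_def by blast
    from acyc[OF this] show False using \<open>a \<noteq> []\<close> by (cases a) auto
  qed
  have "rooted_tree (\<lambda>x y. (x, y) \<in> parcs T) (radius T) 0 \<rho> (pverts T)"
  proof (rule rooted_tree_of_layers[where dep = dep])
    show "dep x \<le> radius T" if "x \<in> pverts T" for x
      using rad[OF that] dep_le by fastforce
    show "x \<in> pverts T" if "(x, y) \<in> parcs T" for x y using that by (rule in_arcsD1)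
    show "(y, x) \<in> parcs T" if "(x, y) \<in> parcs T" for x y using that by (rule arcs_symmetric)
    show "\<exists>y. (x, y) \<in> parcs T \<and> dep x = Suc (dep y)" if "x \<in> pverts T" "x \<noteq> \<rho>" for x
      using that by (rule parent)
  qed (fact pair_finite_verts \<rho> layers dep0 unique)+
  then show ?thesis using \<rho> by blast
qed


section \<open>Blocks that respect the orders\<close>

lemma total_has_max:
  assumes "finite A" "A \<noteq> {}" "total_on A R" "trans R"
  shows "\<exists>m\<in>A. \<forall>x\<in>A. x \<noteq> m \<longrightarrow> (x, m) \<in> R"
  using assms(1,2,3)
proof (induction rule: finite_ne_induct)
  case (singleton x)
  then show ?case by simp
next
  case (insert y A)
  have "total_on A R" using insert.prems by (auto simp: total_on_def)
  then obtain m where m: "m \<in> A" "\<And>x. x \<in> A \<Longrightarrow> x \<noteq> m \<Longrightarrow> (x, m) \<in> R" using insert.IH by blast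
  have ym: "y \<noteq> m" using m insert.hyps by blast
  show ?case
  proof (cases "(y, m) \<in> R")
    case True
    then show ?thesis using m by (intro bexI[of _ m]) auto
  next
    case False
    then have my: "(m, y) \<in> R" using insert.prems m ym by (auto simp: total_on_def)
    have "(x, y) \<in> R" if "x \<in> A" for x
      using m(2)[OF that] my assms(4) by (cases "x = m") (auto dest: transD)
    then show ?thesis by blast
  qed
qed

lemma top_segment:
  assumes "finite A" "total_on A R" "trans R" "s \<le> card A"
  shows "\<exists>B\<subseteq>A. card B = s \<and> (\<forall>x\<in>A - B. \<forall>y\<in>B. (x, y) \<in> R)"
  using assms(4)
proof (induction s)
  case 0
  show ?case by (intro exI[of _ "{}"]) simp
next
  case (Suc s)
  then obtain B where B: "B \<subseteq> A" "card B = s" "\<And>x y. x \<in> A - B \<Longrightarrow> y \<in> B \<Longrightarrow> (x, y) \<in> R"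
    using Suc_leD by blast
  have fB: "finite B" using B assms(1) finite_subset by blast
  have ne: "A - B \<noteq> {}" using B Suc.prems assms(1) by (metis Diff_eq_empty_iff card_mono fB not_less_eq_eq)
  have "total_on (A - B) R" using assms(2) by (auto simp: total_on_def)
  then obtain m where m: "m \<in> A - B" "\<And>x. x \<in> A - B \<Longrightarrow> x \<noteq> m \<Longrightarrow> (x, m) \<in> R"
    using total_has_max[of "A - B" R] ne assms by blast
  show ?case
    by (rule exI[of _ "insert m B"]) (use B m fB in auto)
qed

lemma ordered_blocks:
  assumes "finite P" "total_on P R" "trans R" "antisym R"
    and "finite A" "total_on A Q" "trans Q" "card P * s \<le> card A"
  shows "\<exists>B. (\<forall>u\<in>P. B u \<subseteq> A \<and> card (B u) = s) \<and>
    (\<forall>u\<in>P. \<forall>v\<in>P. u \<noteq> v \<longrightarrow> (u, v) \<in> R \<longrightarrow> (\<forall>x\<in>B u. \<forall>y\<in>B v. x \<noteq> y \<and> (x, y) \<in> Q))"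
  using assms(1,2,5,6,8)
proof (induction "card P" arbitrary: P A)
  case 0
  then show ?case by auto
next
  case (Suc k)
  then have "P \<noteq> {}" by auto
  then obtain m where m: "m \<in> P" "\<And>u. u \<in> P \<Longrightarrow> u \<noteq> m \<Longrightarrow> (u, m) \<in> R"
    using total_has_max[of P R] Suc.prems assms(3) by blast
  have cP: "card P = Suc k" using Suc.hyps by simp
  then have "s \<le> card A" using Suc.prems(5) by simp
  then obtain M where M: "M \<subseteq> A" "card M = s" "\<And>x y. x \<in> A - M \<Longrightarrow> y \<in> M \<Longrightarrow> (x, y) \<in> Q"
    using top_segment[of A Q s] Suc.prems assms(7) by blast
  have "k = card (P - {m})" using cP m Suc.prems(1) by simp
  moreover have "total_on (P - {m}) R" "total_on (A - M) Q"
    using Suc.prems by (auto simp: total_on_def)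
  moreover have "card (P - {m}) * s \<le> card (A - M)"
    using Suc.prems cP m M by (subst card_Diff_subset) (auto intro: finite_subset)
  ultimately have "\<exists>B. (\<forall>u\<in>P - {m}. B u \<subseteq> A - M \<and> card (B u) = s) \<and>
    (\<forall>u\<in>P - {m}. \<forall>v\<in>P - {m}. u \<noteq> v \<longrightarrow> (u, v) \<in> R \<longrightarrow>
      (\<forall>x\<in>B u. \<forall>y\<in>B v. x \<noteq> y \<and> (x, y) \<in> Q))"
    using Suc.prems(1,3) by (intro Suc.hyps(1)) auto
  then obtain B where "\<forall>u\<in>P - {m}. B u \<subseteq> A - M \<and> card (B u) = s"
    and "\<forall>u\<in>P - {m}. \<forall>v\<in>P - {m}. u \<noteq> v \<longrightarrow> (u, v) \<in> R \<longrightarrow>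
      (\<forall>x\<in>B u. \<forall>y\<in>B v. x \<noteq> y \<and> (x, y) \<in> Q)" by (elim exE conjE)
  then have B: "\<And>u. u \<in> P - {m} \<Longrightarrow> B u \<subseteq> A - M \<and> card (B u) = s"
    "\<And>u v x y. u \<in> P - {m} \<Longrightarrow> v \<in> P - {m} \<Longrightarrow> u \<noteq> v \<Longrightarrow> (u, v) \<in> R \<Longrightarrow> x \<in> B u \<Longrightarrow> y \<in> B v \<Longrightarrow>
      x \<noteq> y \<and> (x, y) \<in> Q"
    by simp_all
  show ?case
  proof (intro exI[of _ "B(m := M)"] conjI ballI impI)
    fix u assume "u \<in> P"
    then show "(B(m := M)) u \<subseteq> A" "card ((B(m := M)) u) = s" using B(1)[of u] M by auto
  next
    fix u v x y assume uv: "u \<in> P" "v \<in> P" "u \<noteq> v" "(u, v) \<in> R" "x \<in> (B(m := M)) u" "y \<in> (B(m := M)) v"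
    have um: "u \<noteq> m" using uv m(2)[of v] assms(4) by (auto dest: antisymD)
    then have xA: "x \<in> B u" "x \<in> A - M" using uv B(1)[of u] by auto
    show "x \<noteq> y" "(x, y) \<in> Q"
      using uv um xA M(3)[of x y] B(2)[of u v x y] by (cases "v = m"; auto)+
  qed
qed

lemma contains_if_block_map:
  assumes G: "ordered_bigraph G" and T: "ordered_bigraph T"
    and B1: "\<And>u. u \<in> part1 T \<Longrightarrow> B u \<subseteq> part1 G"
    and B2: "\<And>u. u \<in> part2 T \<Longrightarrow> B u \<subseteq> part2 G"
    and ord1: "\<And>u v x y. u \<in> part1 T \<Longrightarrow> v \<in> part1 T \<Longrightarrow> u \<noteq> v \<Longrightarrow> (u, v) \<in> ord1 T \<Longrightarrow>
      x \<in> B u \<Longrightarrow> y \<in> B v \<Longrightarrow> x \<noteq> y \<and> (x, y) \<in> ord1 G"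
    and ord2: "\<And>u v x y. u \<in> part2 T \<Longrightarrow> v \<in> part2 T \<Longrightarrow> u \<noteq> v \<Longrightarrow> (u, v) \<in> ord2 T \<Longrightarrow>
      x \<in> B u \<Longrightarrow> y \<in> B v \<Longrightarrow> x \<noteq> y \<and> (x, y) \<in> ord2 G"
    and f: "\<And>u. u \<in> pverts (ugraph T) \<Longrightarrow> f u \<in> B u"
    and adj: "\<And>u v. u \<in> pverts (ugraph T) \<Longrightarrow> v \<in> pverts (ugraph T) \<Longrightarrow>
      (f u, f v) \<in> parcs (ugraph G) \<longleftrightarrow> (u, v) \<in> parcs (ugraph T)"
  shows "contains G T"
proof -
  interpret G: ordered_bigraph G by fact
  interpret T: ordered_bigraph T by fact
  have key: "(\<forall>x\<in>P. \<forall>y\<in>P. (x, y) \<in> r \<longleftrightarrow> (f x, f y) \<in> q) \<and> inj_on f P"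
    if lin: "linear_order_on P r" "linear_order_on Q q"
      and PT: "P \<subseteq> pverts (ugraph T)" "\<And>u. u \<in> P \<Longrightarrow> B u \<subseteq> Q"
      and o: "\<And>u v x y. u \<in> P \<Longrightarrow> v \<in> P \<Longrightarrow> u \<noteq> v \<Longrightarrow> (u, v) \<in> r \<Longrightarrow>
          x \<in> B u \<Longrightarrow> y \<in> B v \<Longrightarrow> x \<noteq> y \<and> (x, y) \<in> q"
    for P :: "'b set" and Q :: "'a set" and r q
  proof -
    have refl: "refl_on P r" "refl_on Q q" and anti: "antisym q" and tot: "total_on P r"
      using lin by (auto simp: order_on_defs)
    have fB: "f u \<in> B u" if "u \<in> P" for u using f that PT by blast
    have fwd: "f x \<noteq> f y \<and> (f x, f y) \<in> q" if "x \<in> P" "y \<in> P" "x \<noteq> y" "(x, y) \<in> r" for x y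
      using o[OF that] fB that by blast
    have dich: "(x, y) \<in> r \<or> (y, x) \<in> r" if "x \<in> P" "y \<in> P" "x \<noteq> y" for x y
      using tot that by (auto simp: total_on_def)
    have "(x, y) \<in> r \<longleftrightarrow> (f x, f y) \<in> q" if xy: "x \<in> P" "y \<in> P" for x y
    proof (cases "x = y")
      case True
      then show ?thesis using refl fB[of x] PT(2)[of x] xy by (auto simp: refl_on_def)
    next
      case False
      then show ?thesis
        using fwd[of x y] fwd[of y x] dich[of x y] xy anti by (auto dest: antisymD)
    qed
    moreover have "inj_on f P"
    proof (rule inj_onI)
      fix x y assume "x \<in> P" "y \<in> P" "f x = f y"
      then show "x = y" using fwd[of x y] fwd[of y x] dich[of x y] by auto
    qed
    ultimately show ?thesis by blast
  qed
  have sub: "part1 T \<subseteq> pverts (ugraph T)" "part2 T \<subseteq> pverts (ugraph T)"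
    using T.parts_cover by auto
  have k1: "(\<forall>x\<in>part1 T. \<forall>y\<in>part1 T. (x, y) \<in> ord1 T \<longleftrightarrow> (f x, f y) \<in> ord1 G) \<and> inj_on f (part1 T)"
    by (rule key[OF T.linear_ord1 G.linear_ord1 sub(1)]) (fact B1 ord1)+
  have k2: "(\<forall>x\<in>part2 T. \<forall>y\<in>part2 T. (x, y) \<in> ord2 T \<longleftrightarrow> (f x, f y) \<in> ord2 G) \<and> inj_on f (part2 T)"
    by (rule key[OF T.linear_ord2 G.linear_ord2 sub(2)]) (fact B2 ord2)+
  have im: "f ` part1 T \<subseteq> part1 G" "f ` part2 T \<subseteq> part2 G"
    using f sub B1 B2 by blast+
  have "inj_on f (part1 T \<union> part2 T)"
  proof -
    have "f ` (part1 T - part2 T) \<inter> f ` (part2 T - part1 T) = {}" using im G.parts_disjoint by blast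
    then show ?thesis using conjunct2[OF k1] conjunct2[OF k2] by (simp add: inj_on_Un)
  qed
  then have "inj_on f (pverts (ugraph T))" using T.parts_cover by simp
  then show ?thesis
    using conjunct1[OF k1] conjunct1[OF k2] im adj
    unfolding contains_iff[OF G T] by (intro exI[of _ f]) simp
qed


section \<open>Sizes and degrees\<close>

text \<open>
  A bound for the degrees from \<open>D\<close> to \<open>C\<close> alone bounds the number of edges; once \<open>D\<close> is trimmed
  to the size \<open>M\<close>, at most \<open>M + 1\<close> vertices of \<open>C\<close> exceed this bound in the other direction.
  For \<open>k = 0\<close> the resulting pair is anticomplete.
\<close>

lemma balance_degrees:
  fixes E :: "'b \<Rightarrow> 'b \<Rightarrow> bool" and M :: real
  assumes fin: "finite D" "finite C" and M: "0 \<le> M" "M \<le> real (card D)" "2 * M + 2 \<le> real (card C)"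
    and sym: "\<And>v w. E v w \<Longrightarrow> E w v"
    and k: "\<And>v. v \<in> D \<Longrightarrow> card {w \<in> C. E v w} \<le> k"
  shows "\<exists>D' C'. D' \<subseteq> D \<and> C' \<subseteq> C \<and> M \<le> real (card D') \<and> M \<le> real (card C') \<and>
    (\<forall>v\<in>D'. card {w \<in> C'. E v w} \<le> k) \<and> (\<forall>w\<in>C'. card {v \<in> D'. E w v} \<le> k)"
proof -
  have "nat \<lceil>M\<rceil> \<le> card D" using M by linarith
  then obtain D' where D': "D' \<subseteq> D" "card D' = nat \<lceil>M\<rceil>" by (rule obtain_subset_with_card_n)
  have fD': "finite D'" using D' fin finite_subset by blast
  define C' where "C' = {w \<in> C. card {v \<in> D'. E w v} \<le> k}"
  define L where "L = C - C'"
  have fL: "finite L" using fin by (simp add: L_def)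
  have "(k + 1) * card L = (\<Sum>w\<in>L. k + 1)" by simp
  also have "\<dots> \<le> (\<Sum>w\<in>L. card {v \<in> D'. E w v})"
    by (rule sum_mono) (auto simp: L_def C'_def)
  also have "\<dots> = (\<Sum>w\<in>L. \<Sum>v\<in>D'. if E w v then 1 else 0)"
    by (rule sum.cong[OF refl]) (simp add: fD' sum.If_cases Int_def)
  also have "\<dots> = (\<Sum>v\<in>D'. \<Sum>w\<in>L. if E w v then 1 else 0)" by (rule sum.swap)
  also have "\<dots> = (\<Sum>v\<in>D'. card {w \<in> L. E w v})"
    by (rule sum.cong[OF refl]) (simp add: fL sum.If_cases Int_def)
  also have "\<dots> \<le> (\<Sum>v\<in>D'. k)"
  proof (rule sum_mono)
    fix v assume v: "v \<in> D'"
    have "card {w \<in> L. E w v} \<le> card {w \<in> C. E v w}"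
      using fin sym by (intro card_mono) (auto simp: L_def)
    also have "\<dots> \<le> k" using k v D' by blast
    finally show "card {w \<in> L. E w v} \<le> k" .
  qed
  also have "\<dots> = k * card D'" by simp
  also have "\<dots> \<le> (k + 1) * card D'" by simp
  finally have "card L \<le> card D'" by (simp only: nat_mult_le_cancel1)
  moreover have "card C = card C' + card L"
  proof -
    have "card (C' \<union> L) = card C' + card L"
      using fin by (intro card_Un_disjoint) (auto simp: L_def C'_def)
    moreover have "C' \<union> L = C" by (auto simp: L_def C'_def)
    ultimately show ?thesis by simp
  qed
  ultimately have "M \<le> real (card C')" using M D' by linarith
  moreover have "card {w \<in> C'. E v w} \<le> k" if v: "v \<in> D'" for v
  proof -
    have "card {w \<in> C'. E v w} \<le> card {w \<in> C. E v w}"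
      using fin by (intro card_mono) (auto simp: C'_def)
    also have "\<dots> \<le> k" using k v D' by blast
    finally show ?thesis .
  qed
  moreover have "M \<le> real (card D')" using D' by linarith
  moreover have "C' \<subseteq> C" "\<And>w. w \<in> C' \<Longrightarrow> card {v \<in> D'. E w v} \<le> k" by (auto simp: C'_def)
  ultimately show ?thesis using D'(1) by blast
qed

text \<open>
  The budget hypothesis of the lemma \<open>rooted_copy\<close> for blocks of size \<open>m / t\<close>. The factor \<open>4\<close>
  in the degree bound keeps the main term \<open>3 t \<Delta>\<close> within three quarters of a block.
\<close>

lemma block_budget:
  fixes t :: nat and m \<Delta> x :: real
  assumes t: "2 \<le> t" and m: "real t ^ 4 \<le> m" and \<Delta>: "\<Delta> \<le> m / (4 * real t ^ 2)" and x: "x \<le> m / real t ^ 7"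
  shows "3 * \<Delta> * (real t - 2) + (6 * (real t - 1) * m / real t ^ 7) * (real t - 1) + x
    + (2 * m / real t ^ 3 + 2) \<le> m / real t"
proof -
  have tp: "0 < real t" using t by simp
  have m0: "0 < m" using m tp by (meson less_le_trans zero_less_power)
  have d: "3 * \<Delta> * (real t - 2) \<le> 3 * (m / (4 * real t ^ 2)) * (real t - 2)"
    using \<Delta> t by (intro mult_right_mono mult_left_mono) auto
  consider "t = 2" | "t = 3" | "4 \<le> t" using t by linarith
  then show ?thesis
  proof cases
    case 1
    then show ?thesis using d m x by simp
  next
    case 2
    then show ?thesis using d m x by simp
  next
    case 3
    define s where "s = real t"
    define y where "y = m / s"
    have s: "4 \<le> s" using 3 by (simp add: s_def)
    have y0: "0 < y" using m0 s by (simp add: y_def)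
    have my: "m = y * s" using s by (simp add: y_def)
    have s2: "16 \<le> s ^ 2" using power_mono[of 4 s 2] s by simp
    have s3: "64 \<le> s ^ 3" using power_mono[of 4 s 3] s by simp
    have s4: "256 \<le> s ^ 4" using power_mono[of 4 s 4] s by simp
    have s6: "4096 \<le> s ^ 6" using power_mono[of 4 s 6] s by simp
    have e1: "3 * (m / (4 * s ^ 2)) * (s - 2) \<le> (3 / 4) * y"
      using s y0 by (simp add: my field_simps power2_eq_square)
    have e2: "(6 * (s - 1) * m / s ^ 7) * (s - 1) \<le> (6 / 256) * y"
    proof -
      have "(s - 1) * (s - 1) \<le> s * s" using s by (intro mult_mono) auto
      then have "6 * y * ((s - 1) * (s - 1)) / s ^ 6 \<le> 6 * y * (s * s) / s ^ 6"
        using y0 s by (intro divide_right_mono mult_left_mono) auto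
      also have "\<dots> = 6 * y / s ^ 4" using s by (simp add: field_simps eval_nat_numeral)
      also have "\<dots> \<le> 6 * y / 256" using s4 y0 by (intro divide_left_mono) auto
      moreover have "(6 * (s - 1) * m / s ^ 7) * (s - 1) = 6 * y * ((s - 1) * (s - 1)) / s ^ 6"
        using s by (simp add: my field_simps eval_nat_numeral)
      ultimately show ?thesis by simp
    qed
    have e3: "m / s ^ 7 \<le> y / 4096"
    proof -
      have "m / s ^ 7 = y / s ^ 6" using s by (simp add: my field_simps eval_nat_numeral)
      also have "\<dots> \<le> y / 4096" using s6 y0 by (intro divide_left_mono) auto
      finally show ?thesis .
    qed
    have e4: "2 * m / s ^ 3 \<le> y / 8"
    proof -
      have "2 * m / s ^ 3 = 2 * y / s ^ 2" using s by (simp add: my field_simps eval_nat_numeral)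
      also have "\<dots> \<le> 2 * y / 16" using s2 y0 by (intro divide_left_mono) auto
      finally show ?thesis by simp
    qed
    have e5: "2 \<le> y / 32"
    proof -
      have "s ^ 3 * s \<le> y * s" using m my by (simp add: s_def eval_nat_numeral)
      then have "s ^ 3 \<le> y" using s by simp
      then show ?thesis using s3 by simp
    qed
    show ?thesis
      using d x e1 e2 e3 e4 e5 y0 unfolding s_def[symmetric] y_def[symmetric] by linarith
  qed
qed

text \<open>
  \<open>m / loss t K \<Delta> d\<close> is the size of the vertex sets to which robustness is applied at depth \<open>d\<close>.
  The denominator is the degree \<open>q\<close> that robustness then guarantees. Taking the maximum with \<open>1\<close>
  bounds the loss by \<open>t ^ 8 \<Delta>\<close>, and the estimate \<open>loss_le\<close> depends on this.
\<close>

fun loss :: "real \<Rightarrow> real \<Rightarrow> real \<Rightarrow> nat \<Rightarrow> real" where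
  "loss t K \<Delta> 0 = t ^ 3"
| "loss t K \<Delta> (Suc d) = t ^ 8 * \<Delta> / max 1 (\<Delta> * loss t K \<Delta> d powr - K)"

lemma loss_ge:
  assumes "2 \<le> t" "1 \<le> \<Delta>" "0 \<le> K"
  shows "t ^ 3 \<le> loss t K \<Delta> d" "t ^ 8 \<le> loss t K \<Delta> (Suc d)"
proof -
  have Suc_ge: "t ^ 8 \<le> loss t K \<Delta> (Suc d)" if "1 \<le> loss t K \<Delta> d" for d
  proof -
    have "loss t K \<Delta> d powr - K \<le> loss t K \<Delta> d powr 0"
      using that assms by (intro powr_mono) auto
    then have "\<Delta> * loss t K \<Delta> d powr - K \<le> \<Delta> * 1"
      using assms that by (intro mult_left_mono) auto
    then have "max 1 (\<Delta> * loss t K \<Delta> d powr - K) \<le> \<Delta>" using assms by simp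
    then have "t ^ 8 * 1 \<le> t ^ 8 * (\<Delta> / max 1 (\<Delta> * loss t K \<Delta> d powr - K))"
      using assms by (intro mult_left_mono) (simp_all add: pos_le_divide_eq)
    then show ?thesis by simp
  qed
  have "t ^ 3 \<le> t ^ 8" using assms by (simp add: power_increasing)
  moreover have "1 \<le> t ^ 3" using assms by simp
  ultimately have ge: "t ^ 3 \<le> loss t K \<Delta> d \<and> 1 \<le> loss t K \<Delta> d" for d
    using Suc_ge by (induction d) (auto intro: order_trans simp del: loss.simps(2))
  then show "t ^ 3 \<le> loss t K \<Delta> d" "t ^ 8 \<le> loss t K \<Delta> (Suc d)" using Suc_ge by blast+
qed

lemma loss_Suc_le:
  assumes "2 \<le> t" "1 \<le> \<Delta>" "0 \<le> K"
  shows "loss t K \<Delta> (Suc d) \<le> t ^ 8 * min \<Delta> (loss t K \<Delta> d powr K)"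
proof -
  have "0 < t ^ 3" using assms by simp
  then have L: "0 < loss t K \<Delta> d" using loss_ge(1)[OF assms, of d] by linarith
  define q where "q = max 1 (\<Delta> * loss t K \<Delta> d powr - K)"
  have "\<Delta> / q \<le> \<Delta>" using assms by (simp add: q_def divide_le_eq)
  moreover have "\<Delta> / q \<le> loss t K \<Delta> d powr K"
  proof -
    have "\<Delta> = (\<Delta> * loss t K \<Delta> d powr - K) * loss t K \<Delta> d powr K"
      using L by (simp add: powr_minus)
    also have "\<dots> \<le> q * loss t K \<Delta> d powr K" by (intro mult_right_mono) (simp_all add: q_def)
    finally show ?thesis by (simp add: q_def divide_le_eq mult.commute)
  qed
  ultimately have "t ^ 8 * (\<Delta> / q) \<le> t ^ 8 * min \<Delta> (loss t K \<Delta> d powr K)"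
    using assms by (intro mult_left_mono) auto
  then show ?thesis by (simp add: q_def)
qed

text \<open>
  The exponent of \<open>t\<close> on the left is at most \<open>3 K + 5\<close> for \<open>d = 0\<close>, which is where \<open>5 \<le> K\<close>
  enters, and each step multiplies its bound by \<open>K\<close>.
\<close>

lemma loss_growth:
  assumes t: "2 \<le> t" and \<Delta>: "1 \<le> \<Delta>" and K: "5 \<le> K"
  shows "t ^ 8 * loss t K \<Delta> d powr (K - 1) \<le> t powr (4 * K ^ Suc d)"
proof (induction d)
  case 0
  have "t ^ 8 * loss t K \<Delta> 0 powr (K - 1) = t powr 8 * (t powr 3) powr (K - 1)"
    using t by (simp add: powr_numeral)
  also have "\<dots> = t powr (3 * K + 5)" by (simp add: powr_powr algebra_simps flip: powr_add)
  also have "\<dots> \<le> t powr (4 * K ^ Suc 0)" using t K by (intro powr_mono) auto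
  finally show ?case .
next
  case (Suc d)
  have K0: "0 \<le> K" using K by simp
  let ?L = "loss t K \<Delta> d"
  have "0 < t ^ 3" using t by simp
  then have L: "0 < ?L" "0 < loss t K \<Delta> (Suc d)"
    using loss_ge(1)[OF t \<Delta> K0, of d] loss_ge(1)[OF t \<Delta> K0, of "Suc d"] by linarith+
  have "loss t K \<Delta> (Suc d) \<le> t ^ 8 * ?L powr K"
    using loss_Suc_le[OF t \<Delta> K0, of d] t by (auto intro: order_trans[OF _ mult_left_mono])
  then have "loss t K \<Delta> (Suc d) powr (K - 1) \<le> (t ^ 8 * ?L powr K) powr (K - 1)"
    using L K by (intro powr_mono2) auto
  then have "t ^ 8 * loss t K \<Delta> (Suc d) powr (K - 1) \<le> t ^ 8 * (t ^ 8 * ?L powr K) powr (K - 1)"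
    using t by (intro mult_left_mono) auto
  also have "\<dots> = t powr 8 * (t powr 8 * ?L powr K) powr (K - 1)"
    using t by (simp add: powr_numeral)
  also have "\<dots> = (t powr 8 * ?L powr (K - 1)) powr K"
  proof -
    have "t powr 8 * (t powr 8 * ?L powr K) powr (K - 1) =
        t powr 8 * (t powr (8 * (K - 1)) * ?L powr (K * (K - 1)))"
      by (simp only: powr_mult powr_powr)
    also have "\<dots> = t powr (8 + 8 * (K - 1)) * ?L powr (K * (K - 1))"
      by (simp only: powr_add mult.assoc)
    also have "\<dots> = t powr (8 * K) * ?L powr ((K - 1) * K)" by (simp add: algebra_simps)
    also have "\<dots> = (t powr 8 * ?L powr (K - 1)) powr K"
      by (simp only: powr_mult powr_powr)
    finally show ?thesis .
  qed
  also have "\<dots> \<le> (t powr (4 * K ^ Suc d)) powr K"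
  proof (rule powr_mono2)
    show "t powr 8 * ?L powr (K - 1) \<le> t powr (4 * K ^ Suc d)"
      using Suc.IH t by (simp add: powr_numeral del: power_Suc)
  qed (use K0 in simp_all)
  also have "\<dots> = t powr (4 * K ^ Suc (Suc d))" by (simp add: powr_powr mult_ac)
  finally show ?case .
qed

text \<open>
  With \<open>M = min \<Delta> (y powr K)\<close> for the previous loss \<open>y\<close>, the loss is at most
  \<open>t ^ 8 M = t ^ 8 (M powr (1 - 1 / K)) (M powr (1 / K)) \<le> t ^ 8 (y powr (K - 1)) (\<Delta> powr (1 / K))\<close>.
  The factor \<open>\<Delta> powr (1 / K)\<close> is recovered from the size of the extremal pair, so only
  \<open>K - 1\<close> powers of \<open>y\<close> are paid for.
\<close>

lemma loss_le:
  assumes t: "2 \<le> t" and \<Delta>: "1 \<le> \<Delta>" and K: "5 \<le> K" and d: "d < r"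
  shows "loss t K \<Delta> d \<le> t powr (4 * K ^ (r - 1)) * \<Delta> powr (1 / K)"
proof (cases d)
  case 0
  have "1 \<le> K ^ (r - 1)" using K by simp
  then have "t powr 3 \<le> t powr (4 * K ^ (r - 1))" using t by (intro powr_mono) auto
  moreover have "1 \<le> \<Delta> powr (1 / K)" using \<Delta> K by (simp add: ge_one_powr_ge_zero)
  ultimately have "t powr 3 * 1 \<le> t powr (4 * K ^ (r - 1)) * \<Delta> powr (1 / K)"
    by (intro mult_mono) auto
  then show ?thesis using 0 t by (simp add: powr_numeral)
next
  case (Suc e)
  have K0: "0 \<le> K" using K by simp
  let ?L = "loss t K \<Delta> e"
  define M where "M = min \<Delta> (?L powr K)"
  have "0 < t ^ 3" using t by simp
  then have L: "0 < ?L" using loss_ge(1)[OF t \<Delta> K0, of e] by linarith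
  then have M: "0 < M" using \<Delta> by (simp add: M_def)
  have "M = M powr (1 / K) * M powr (1 - 1 / K)" using M by (simp flip: powr_add)
  also have "\<dots> \<le> \<Delta> powr (1 / K) * (?L powr K) powr (1 - 1 / K)"
    using M K by (intro mult_mono powr_mono2) (auto simp: M_def)
  also have "(?L powr K) powr (1 - 1 / K) = ?L powr (K - 1)"
    using K by (simp add: powr_powr algebra_simps)
  finally have "t ^ 8 * M \<le> t ^ 8 * (\<Delta> powr (1 / K) * ?L powr (K - 1))"
    using t by (intro mult_left_mono) auto
  also have "\<dots> = (t ^ 8 * ?L powr (K - 1)) * \<Delta> powr (1 / K)" by simp
  also have "\<dots> \<le> t powr (4 * K ^ Suc e) * \<Delta> powr (1 / K)"
    using loss_growth[OF t \<Delta> K, of e] by (intro mult_right_mono) auto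
  also have "\<dots> \<le> t powr (4 * K ^ (r - 1)) * \<Delta> powr (1 / K)"
    using t K d Suc by (intro mult_right_mono powr_mono mult_left_mono power_increasing) auto
  finally show ?thesis using loss_Suc_le[OF t \<Delta> K0, of e] Suc by (simp add: M_def)
qed


section \<open>The extremal pair\<close>

text \<open>
  Let \<open>k\<close> be the least positive integer such that some pair of size
  \<open>\<mu> k = n (4 t ^ 2 k / n) powr (1 / K)\<close> has maximum degree at most \<open>k\<close>. If robustness fails with
  loss \<open>y\<close>, balancing the degrees gives a pair of size \<open>\<mu> k / y\<close> and maximum degree
  \<open>j \<le> k y powr - K\<close>, where \<open>\<mu> j \<le> \<mu> k / y\<close>. This contradicts minimality if \<open>j > 0\<close>, and if
  \<open>j = 0\<close> the pair is anticomplete.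
\<close>

lemma extremal_pair:
  fixes E :: "'b \<Rightarrow> 'b \<Rightarrow> bool" and V1 V2 :: "'b set" and n t r :: nat and K :: real
  defines "z \<equiv> real n * real t powr (- 5 * K ^ (r - 1))"
  assumes fin: "finite V1" "finite V2"
    and sym: "\<And>v w. E v w \<Longrightarrow> E w v"
    and n: "real t powr (K ^ r) = real n" and t: "2 \<le> t" and r: "1 \<le> r" and K: "5 < K"
    and card: "n \<le> card V1" "n \<le> card V2"
    and deg1: "\<And>v. v \<in> V1 \<Longrightarrow> real (card {w \<in> V2. E v w}) \<le> real n / (4 * real t ^ 2)"
    and deg2: "\<And>v. v \<in> V2 \<Longrightarrow> real (card {w \<in> V1. E v w}) \<le> real n / (4 * real t ^ 2)"
    and no: "\<And>Z1 Z2. Z1 \<subseteq> V1 \<Longrightarrow> Z2 \<subseteq> V2 \<Longrightarrow> z \<le> real (card Z1) \<Longrightarrow> z \<le> real (card Z2) \<Longrightarrow>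
      \<exists>x\<in>Z1. \<exists>y\<in>Z2. E x y"
  shows "\<exists>m \<Delta> A1 A2. A1 \<subseteq> V1 \<and> A2 \<subseteq> V2 \<and> m \<le> real (card A1) \<and> m \<le> real (card A2) \<and>
    real t ^ 4 \<le> m \<and> 1 \<le> \<Delta> \<and> \<Delta> \<le> m / (4 * real t ^ 2) \<and>
    (\<forall>v\<in>A1. real (card {w \<in> A2. E v w}) \<le> \<Delta>) \<and> (\<forall>v\<in>A2. real (card {w \<in> A1. E v w}) \<le> \<Delta>) \<and>
    (\<forall>d D C. d < r \<longrightarrow> D \<subseteq> A1 \<and> C \<subseteq> A2 \<or> D \<subseteq> A2 \<and> C \<subseteq> A1 \<longrightarrow>
      m / loss t K \<Delta> d \<le> real (card D) \<longrightarrow> 2 * m / real t ^ 3 + 2 \<le> real (card C) \<longrightarrow>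
      (\<exists>v\<in>D. max 1 (\<Delta> * loss t K \<Delta> d powr - K) \<le> real (card {w \<in> C. E v w})))"
proof -
  have tr: "2 \<le> real t" using t by simp
  have K1: "1 \<le> K ^ (r - 1)" using K by simp
  have Kr: "K ^ r = K * K ^ (r - 1)" using r by (cases r) auto
  have n0: "0 < real n" using n tr by (metis powr_gt_zero not_numeral_le_zero)
  have nK: "real n powr (1 / K) = real t powr (K ^ (r - 1))"
    unfolding n[symmetric] using K by (simp add: powr_powr Kr)
  have n4: "4 * real t ^ 2 \<le> real n"
  proof -
    have "4 * real t ^ 2 \<le> real t ^ 2 * real t ^ 2"
      using power_mono[of 2 "real t" 2] tr by (intro mult_right_mono) auto
    also have "\<dots> = real t powr 4" using tr by (simp add: powr_numeral flip: power_add)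
    also have "\<dots> \<le> real t powr (K ^ r)"
    proof (rule powr_mono)
      have "4 * 1 \<le> K * K ^ (r - 1)" using K K1 by (intro mult_mono) auto
      then show "4 \<le> K ^ r" using Kr by simp
    qed (use tr in simp)
    finally show ?thesis using n by simp
  qed
  define \<mu> where "\<mu> k = real n * (4 * real t ^ 2 * real k / real n) powr (1 / K)" for k :: nat
  define good where "good k \<longleftrightarrow> 1 \<le> k \<and> 4 * real t ^ 2 * real k \<le> real n \<and>
    (\<exists>A1 A2. A1 \<subseteq> V1 \<and> A2 \<subseteq> V2 \<and> \<mu> k \<le> real (card A1) \<and> \<mu> k \<le> real (card A2) \<and>
      (\<forall>v\<in>A1. card {w \<in> A2. E v w} \<le> k) \<and> (\<forall>v\<in>A2. card {w \<in> A1. E v w} \<le> k))" for k :: nat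
  define k0 where "k0 = nat \<lfloor>real n / (4 * real t ^ 2)\<rfloor>"
  have "good k0"
  proof -
    have 1: "1 \<le> real n / (4 * real t ^ 2)" using n4 tr by (simp add: pos_le_divide_eq)
    then have "1 \<le> \<lfloor>real n / (4 * real t ^ 2)\<rfloor>" by simp
    then have k1: "1 \<le> k0" unfolding k0_def by linarith
    have "real k0 \<le> real n / (4 * real t ^ 2)" using 1 unfolding k0_def by linarith
    then have k2: "4 * real t ^ 2 * real k0 \<le> real n"
      using tr by (simp add: pos_le_divide_eq mult.commute)
    have "(4 * real t ^ 2 * real k0 / real n) powr (1 / K) \<le> 1"
      using k2 n0 K by (intro powr_le1) auto
    then have \<mu>n: "\<mu> k0 \<le> real n" using n0 by (simp add: \<mu>_def mult_left_le)
    have "card {w \<in> V2. E v w} \<le> k0" if "v \<in> V1" for v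
      using deg1[OF that] unfolding k0_def by linarith
    moreover have "card {w \<in> V1. E v w} \<le> k0" if "v \<in> V2" for v
      using deg2[OF that] unfolding k0_def by linarith
    ultimately show ?thesis
      unfolding good_def using k1 k2 \<mu>n card
      by (intro conjI exI[of _ V1] exI[of _ V2]) auto
  qed
  define k where "k = (LEAST k. good k)"
  have k: "good k" unfolding k_def using \<open>good k0\<close> by (rule LeastI)
  have least: "k \<le> j" if "good j" for j unfolding k_def using that by (rule Least_le)
  obtain A1 A2 where k1: "1 \<le> k" "4 * real t ^ 2 * real k \<le> real n"
    and A: "A1 \<subseteq> V1" "A2 \<subseteq> V2" "\<mu> k \<le> real (card A1)" "\<mu> k \<le> real (card A2)"
    and deg: "\<And>v. v \<in> A1 \<Longrightarrow> card {w \<in> A2. E v w} \<le> k" "\<And>v. v \<in> A2 \<Longrightarrow> card {w \<in> A1. E v w} \<le> k"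
    using k unfolding good_def by blast
  define m where "m = \<mu> k"
  have k0: "1 \<le> real k" using k1 by simp
  have m_ge: "real n * real t powr (- (K ^ (r - 1))) * real k powr (1 / K) \<le> m"
  proof -
    have "1 \<le> real t ^ 2" using tr by (intro one_le_power) simp
    then have t4: "1 \<le> 4 * real t ^ 2" by linarith
    have "real k / real n \<le> 4 * real t ^ 2 * real k / real n"
      using n0 k0 t4 by (intro divide_right_mono) auto
    then have "(real k / real n) powr (1 / K) \<le> (4 * real t ^ 2 * real k / real n) powr (1 / K)"
      using K n0 by (intro powr_mono2) auto
    moreover have "(real k / real n) powr (1 / K) = real k powr (1 / K) * real t powr (- (K ^ (r - 1)))"
    proof -
      have "(real k / real n) powr (1 / K) = real k powr (1 / K) / real n powr (1 / K)"
        by (rule powr_divide)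
      also have "\<dots> = real k powr (1 / K) / real t powr (K ^ (r - 1))" by (simp only: nK)
      also have "\<dots> = real k powr (1 / K) * real t powr (- (K ^ (r - 1)))"
        by (simp add: powr_minus_divide)
      finally show ?thesis .
    qed
    ultimately show ?thesis using n0 by (simp add: m_def \<mu>_def mult_ac)
  qed
  have m_t: "real t ^ 4 \<le> m"
  proof -
    have "4 * 1 \<le> (K - 1) * K ^ (r - 1)" using K K1 by (intro mult_mono) auto
    then have "real t powr 4 \<le> real t powr (K ^ r - K ^ (r - 1))"
      using tr by (intro powr_mono) (auto simp: Kr algebra_simps)
    also have "\<dots> = real n * real t powr (- (K ^ (r - 1)))"
      using tr by (simp add: powr_diff n powr_minus divide_inverse)
    also have "\<dots> * 1 \<le> \<dots> * real k powr (1 / K)"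
      using k0 K by (intro mult_left_mono) (auto simp: ge_one_powr_ge_zero)
    also have "\<dots> \<le> m" by (rule m_ge)
    finally show ?thesis using tr by (simp add: powr_numeral)
  qed
  have k_m: "real k \<le> m / (4 * real t ^ 2)"
  proof -
    define x where "x = 4 * real t ^ 2 * real k / real n"
    have x: "0 < x" "x \<le> 1" using k1 k0 n0 tr by (auto simp: x_def)
    have "x powr 1 \<le> x powr (1 / K)" using x K by (intro powr_mono') auto
    then have "real n * x \<le> real n * x powr (1 / K)" using x n0 by (intro mult_left_mono) auto
    also have "\<dots> = m" by (simp add: m_def \<mu>_def x_def)
    finally have "4 * real t ^ 2 * real k \<le> m" using n0 by (simp add: x_def)
    then show ?thesis using tr by (simp add: pos_le_divide_eq mult_ac)
  qed
  have rob: "\<exists>v\<in>D. max 1 (real k * loss t K (real k) d powr - K) \<le> real (card {w \<in> C. E v w})"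
    if d: "d < r" and DC: "D \<subseteq> A1 \<and> C \<subseteq> A2 \<or> D \<subseteq> A2 \<and> C \<subseteq> A1"
      and D: "m / loss t K (real k) d \<le> real (card D)" and C: "2 * m / real t ^ 3 + 2 \<le> real (card C)"
    for d D C
  proof (rule ccontr)
    assume contr: "\<not> ?thesis"
    define Y where "Y = loss t K (real k) d"
    have Y3: "real t ^ 3 \<le> Y" unfolding Y_def using tr k0 K by (intro loss_ge) auto
    have "1 < real t ^ 3" using tr by simp
    then have Y1: "1 < Y" using Y3 by linarith
    have m0: "0 < m" using m_t tr by (meson less_le_trans zero_less_power zero_less_numeral)
    have zM: "z \<le> m / Y"
    proof -
      have Kp: "0 < real k powr (1 / K)" using k0 by simp
      have "z * Y \<le> z * (real t powr (4 * K ^ (r - 1)) * real k powr (1 / K))"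
        unfolding Y_def z_def using tr k0 K d by (intro mult_left_mono loss_le) auto
      also have "\<dots> = real n * (real t powr (- 5 * K ^ (r - 1)) * real t powr (4 * K ^ (r - 1))) * real k powr (1 / K)"
        by (simp add: z_def)
      also have "real t powr (- 5 * K ^ (r - 1)) * real t powr (4 * K ^ (r - 1)) = real t powr (- (K ^ (r - 1)))"
        by (simp flip: powr_add)
      also have "real n * real t powr (- (K ^ (r - 1))) * real k powr (1 / K) \<le> m" by (rule m_ge)
      finally show ?thesis using Y1 by (simp add: pos_le_divide_eq)
    qed
    define x where "x = real k * Y powr - K"
    define j where "j = nat \<lfloor>x\<rfloor>"
    have x0: "0 \<le> x" by (simp add: x_def)
    have Dj: "card {w \<in> C. E v w} \<le> j" if "v \<in> D" for v
    proof -
      have "real (card {w \<in> C. E v w}) < max 1 x"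
        using contr that by (auto simp: x_def Y_def not_le)
      then show ?thesis unfolding j_def by linarith
    qed
    have C2: "2 * (m / Y) + 2 \<le> real (card C)"
    proof -
      have "2 * m / Y \<le> 2 * m / real t ^ 3" using Y3 Y1 m0 tr by (intro divide_left_mono) auto
      then show ?thesis using C by simp
    qed
    have finA: "finite A1" "finite A2" using A(1,2) fin finite_subset by metis+
    have finDC: "finite D" "finite C" using DC finA finite_subset by metis+
    have mY: "0 \<le> m / Y" "m / Y \<le> real (card D)" using m0 Y1 D by (simp_all add: Y_def)
    have "\<exists>D' C'. D' \<subseteq> D \<and> C' \<subseteq> C \<and> m / Y \<le> real (card D') \<and> m / Y \<le> real (card C') \<and>
      (\<forall>v\<in>D'. card {w \<in> C'. E v w} \<le> j) \<and> (\<forall>w\<in>C'. card {v \<in> D'. E w v} \<le> j)"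
      by (rule balance_degrees[OF finDC mY C2 sym Dj])
    then obtain D' C' where DC': "D' \<subseteq> D" "C' \<subseteq> C" "m / Y \<le> real (card D')" "m / Y \<le> real (card C')"
      and j: "\<forall>v\<in>D'. card {w \<in> C'. E v w} \<le> j" "\<forall>w\<in>C'. card {v \<in> D'. E w v} \<le> j"
      by (elim exE conjE)
    have "\<exists>B1 B2. B1 \<subseteq> A1 \<and> B2 \<subseteq> A2 \<and> m / Y \<le> real (card B1) \<and> m / Y \<le> real (card B2) \<and>
      (\<forall>v\<in>B1. card {w \<in> B2. E v w} \<le> j) \<and> (\<forall>w\<in>B2. card {v \<in> B1. E w v} \<le> j)"
      using DC
    proof
      assume "D \<subseteq> A1 \<and> C \<subseteq> A2"
      then show ?thesis using DC' j by (intro exI[of _ D'] exI[of _ C']) auto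
    next
      assume "D \<subseteq> A2 \<and> C \<subseteq> A1"
      then show ?thesis using DC' j by (intro exI[of _ C'] exI[of _ D']) auto
    qed
    then obtain B1 B2 where B: "B1 \<subseteq> A1" "B2 \<subseteq> A2" "m / Y \<le> real (card B1)" "m / Y \<le> real (card B2)"
      "\<forall>v\<in>B1. card {w \<in> B2. E v w} \<le> j" "\<forall>w\<in>B2. card {v \<in> B1. E w v} \<le> j"
      by (elim exE conjE)
    show False
    proof (cases "j = 0")
      case True
      have "\<exists>v\<in>B1. \<exists>w\<in>B2. E v w"
        using B(1-4) A(1,2) zM by (intro no) (blast | linarith)+
      then obtain v w where vw: "v \<in> B1" "w \<in> B2" "E v w" by blast
      have "finite B2" using B(2) finA(2) by (rule finite_subset)
      then have "card {w \<in> B2. E v w} \<noteq> 0" using vw by auto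
      then show False using B(5) vw(1) True by simp
    next
      case False
      have jx: "real j \<le> x" using x0 unfolding j_def by linarith
      have "Y powr - K < Y powr 0" using Y1 K by (intro powr_less_mono) auto
      then have "x < real k" using k0 Y1 by (simp add: x_def)
      then have jk: "j < k" using jx by linarith
      have "\<mu> j \<le> m / Y"
      proof -
        have "4 * real t ^ 2 * real j / real n \<le> 4 * real t ^ 2 * x / real n"
          using jx n0 by (intro divide_right_mono mult_left_mono) auto
        then have "(4 * real t ^ 2 * real j / real n) powr (1 / K) \<le>
            ((4 * real t ^ 2 * real k / real n) * Y powr - K) powr (1 / K)"
          using K n0 by (intro powr_mono2) (auto simp: x_def)
        also have "\<dots> = (4 * real t ^ 2 * real k / real n) powr (1 / K) * Y powr (- K * (1 / K))"
          by (simp only: powr_mult powr_powr)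
        also have "- K * (1 / K) = - 1" using K by simp
        also have "Y powr - 1 = 1 / Y" using Y1 by (simp add: powr_minus divide_inverse)
        finally have "\<mu> j \<le> real n * ((4 * real t ^ 2 * real k / real n) powr (1 / K) * (1 / Y))"
          unfolding \<mu>_def using n0 by (intro mult_left_mono) auto
        then show ?thesis by (simp add: m_def \<mu>_def)
      qed
      moreover have "4 * real t ^ 2 * real j \<le> real n"
      proof -
        have "4 * real t ^ 2 * real j \<le> 4 * real t ^ 2 * real k"
          using jk by (intro mult_left_mono) auto
        then show ?thesis using k1 by linarith
      qed
      ultimately have "good j"
        unfolding good_def using B A False
        by (intro conjI exI[of _ B1] exI[of _ B2]) (auto intro: order_trans)
      then show False using least jk by fastforce
    qed
  qed
  show ?thesis
  proof (intro exI conjI)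
    show "\<forall>d D C. d < r \<longrightarrow> D \<subseteq> A1 \<and> C \<subseteq> A2 \<or> D \<subseteq> A2 \<and> C \<subseteq> A1 \<longrightarrow>
      m / loss t K (real k) d \<le> real (card D) \<longrightarrow> 2 * m / real t ^ 3 + 2 \<le> real (card C) \<longrightarrow>
      (\<exists>v\<in>D. max 1 (real k * loss t K (real k) d powr - K) \<le> real (card {w \<in> C. E v w}))"
      using rob by blast
  qed (use A deg m_t k0 k_m in \<open>auto simp: m_def\<close>)
qed


section \<open>Finding the ordered tree\<close>

lemma rooted_tree_edge:
  assumes "rooted_tree A r d u S" "2 \<le> card S"
  shows "d < r \<and> (\<exists>c. A u c)"
  using assms(1)
proof cases
  case (node C T)
  have "C \<noteq> {}" using node(1) assms(2) by auto
  then obtain c where c: "c \<in> C" by blast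
  then have "c \<in> T c" using node rooted_tree_root by metis
  then have "A u c" using node c by blast
  then show ?thesis using node \<open>C \<noteq> {}\<close> by blast
qed

lemma (in ordered_bigraph) degree_card:
  assumes "v \<in> part1 B" "w \<in> part2 B"
  shows "out_degree (with_proj (ugraph B)) v = card {x \<in> part2 B. (v, x) \<in> parcs (ugraph B)}"
    and "out_degree (with_proj (ugraph B)) w = card {x \<in> part1 B. (w, x) \<in> parcs (ugraph B)}"
proof -
  have *: "out_degree (with_proj (ugraph B)) v = card {x. (v, x) \<in> parcs (ugraph B)}" for v
  proof -
    have "out_arcs (with_proj (ugraph B)) v = Pair v ` {x. (v, x) \<in> parcs (ugraph B)}"
      by (auto simp: out_arcs_def)
    then show ?thesis unfolding out_degree_def by (simp add: card_image inj_on_def)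
  qed
  have "{x. (v, x) \<in> parcs (ugraph B)} = {x \<in> part2 B. (v, x) \<in> parcs (ugraph B)}"
    "{x. (w, x) \<in> parcs (ugraph B)} = {x \<in> part1 B. (w, x) \<in> parcs (ugraph B)}"
    using arcs_between_parts parts_disjoint assms by blast+
  then show "out_degree (with_proj (ugraph B)) v = card {x \<in> part2 B. (v, x) \<in> parcs (ugraph B)}"
    "out_degree (with_proj (ugraph B)) w = card {x \<in> part1 B. (w, x) \<in> parcs (ugraph B)}"
    using * by metis+
qed

text \<open>
  Both parts of \<open>T\<close> are nonempty, so each side is cut into at most \<open>t - 1\<close> blocks; this leaves
  room to round the block size up to an integer that is at least \<open>m / t\<close>.
\<close>

lemma contains_if_robust:
  fixes T :: "'a obigraph" and G :: "'b obigraph" and m \<Delta> K :: real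
  assumes T: "ordered_bigraph T" and tree: "rooted_tree (\<lambda>x y. (x, y) \<in> parcs (ugraph T)) r 0 \<rho> (pverts (ugraph T))"
    and \<rho>: "\<rho> \<in> pverts (ugraph T)"
    and t: "card (pverts (ugraph T)) = t" "2 \<le> t"
    and G: "ordered_bigraph G"
    and A: "A1 \<subseteq> part1 G" "A2 \<subseteq> part2 G" "m \<le> real (card A1)" "m \<le> real (card A2)"
    and m: "real t ^ 4 \<le> m" and \<Delta>: "1 \<le> \<Delta>" "\<Delta> \<le> m / (4 * real t ^ 2)" and K: "0 \<le> K"
    and deg1: "\<And>v. v \<in> A1 \<Longrightarrow> real (card {w \<in> A2. (v, w) \<in> parcs (ugraph G)}) \<le> \<Delta>"
    and deg2: "\<And>v. v \<in> A2 \<Longrightarrow> real (card {w \<in> A1. (v, w) \<in> parcs (ugraph G)}) \<le> \<Delta>"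
    and rob: "\<And>d D C. d < r \<Longrightarrow> D \<subseteq> A1 \<and> C \<subseteq> A2 \<or> D \<subseteq> A2 \<and> C \<subseteq> A1 \<Longrightarrow>
      m / loss t K \<Delta> d \<le> real (card D) \<Longrightarrow> 2 * m / real t ^ 3 + 2 \<le> real (card C) \<Longrightarrow>
      \<exists>v\<in>D. max 1 (\<Delta> * loss t K \<Delta> d powr - K) \<le> real (card {w \<in> C. (v, w) \<in> parcs (ugraph G)})"
  shows "contains G T"
proof -
  interpret T: ordered_bigraph T by fact
  interpret G: ordered_bigraph G by fact
  let ?A = "\<lambda>x y. (x, y) \<in> parcs (ugraph T)" and ?E = "\<lambda>v w. (v, w) \<in> parcs (ugraph G)"
  have tr: "2 \<le> real t" using t by simp
  have m0: "0 < m" using m tr by (meson less_le_trans zero_less_power zero_less_numeral)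
  have finT: "finite (part1 T)" "finite (part2 T)"
    using T.parts_cover T.pair_finite_verts by (metis finite_Un)+
  have finA: "finite A1" "finite A2"
    using G.parts_cover G.pair_finite_verts A by (metis finite_Un finite_subset)+
  have cT: "card (part1 T) + card (part2 T) = t"
    using T.parts_cover T.parts_disjoint t finT by (metis card_Un_disjoint)
  obtain c where "?A \<rho> c" using rooted_tree_edge[OF tree] t by auto
  then have "part1 T \<noteq> {}" "part2 T \<noteq> {}" using T.arcs_between_parts by blast+
  then have "1 \<le> card (part1 T)" "1 \<le> card (part2 T)"
    using finT by (simp_all add: Suc_le_eq card_gt_0_iff)
  then have parts: "card (part1 T) \<le> t - 1" "card (part2 T) \<le> t - 1" using cT by linarith+
  define s where "s = nat \<lceil>m / real t\<rceil>"
  have s_ge: "m / real t \<le> real s" unfolding s_def by linarith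
  have s_le: "k * s \<le> card A'" if "k \<le> t - 1" "m \<le> real (card A')" for k and A' :: "'b set"
  proof -
    have "real s \<le> m / real t + 1" unfolding s_def using m0 tr
      by (smt (verit) divide_nonneg_pos of_int_ceiling_le_add_one of_nat_nat zero_le_ceiling)
    then have "real k * real s \<le> (real t - 1) * (m / real t + 1)"
      using that(1) t m0 by (intro mult_mono) auto
    also have "\<dots> \<le> m"
    proof -
      have "real t * real t \<le> real t ^ 4"
        using tr power_increasing[of 2 4 "real t"] by (simp add: power2_eq_square)
      then have "real t * real t \<le> m" using m by linarith
      then have "real t \<le> m / real t" using tr by (simp add: pos_le_divide_eq)
      moreover have "(real t - 1) * (m / real t + 1) = m - m / real t + real t - 1"
        using tr by (simp add: field_simps)
      ultimately show ?thesis by linarith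
    qed
    finally have "real (k * s) \<le> real (card A')" using that by simp
    then show ?thesis by linarith
  qed
  have lin: "total_on (part1 T) (ord1 T)" "trans (ord1 T)" "antisym (ord1 T)"
    "total_on (part2 T) (ord2 T)" "trans (ord2 T)" "antisym (ord2 T)"
    "total_on A1 (ord1 G)" "trans (ord1 G)" "total_on A2 (ord2 G)" "trans (ord2 G)"
    using T.linear_ord1 T.linear_ord2 G.linear_ord1 G.linear_ord2 A
    by (auto simp: order_on_defs intro: total_on_subset)
  have "\<exists>B. (\<forall>u\<in>part1 T. B u \<subseteq> A1 \<and> card (B u) = s) \<and>
    (\<forall>u\<in>part1 T. \<forall>v\<in>part1 T. u \<noteq> v \<longrightarrow> (u, v) \<in> ord1 T \<longrightarrow>
      (\<forall>x\<in>B u. \<forall>y\<in>B v. x \<noteq> y \<and> (x, y) \<in> ord1 G))"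
    by (rule ordered_blocks) (use finT lin finA s_le parts A in auto)
  then obtain B1 where "\<forall>u\<in>part1 T. B1 u \<subseteq> A1 \<and> card (B1 u) = s"
    "\<forall>u\<in>part1 T. \<forall>v\<in>part1 T. u \<noteq> v \<longrightarrow> (u, v) \<in> ord1 T \<longrightarrow>
      (\<forall>x\<in>B1 u. \<forall>y\<in>B1 v. x \<noteq> y \<and> (x, y) \<in> ord1 G)" by (elim exE conjE)
  then have B1: "\<And>u. u \<in> part1 T \<Longrightarrow> B1 u \<subseteq> A1" "\<And>u. u \<in> part1 T \<Longrightarrow> card (B1 u) = s"
    "\<And>u v x y. u \<in> part1 T \<Longrightarrow> v \<in> part1 T \<Longrightarrow> u \<noteq> v \<Longrightarrow> (u, v) \<in> ord1 T \<Longrightarrow>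
      x \<in> B1 u \<Longrightarrow> y \<in> B1 v \<Longrightarrow> x \<noteq> y \<and> (x, y) \<in> ord1 G"
    by simp_all
  have "\<exists>B. (\<forall>u\<in>part2 T. B u \<subseteq> A2 \<and> card (B u) = s) \<and>
    (\<forall>u\<in>part2 T. \<forall>v\<in>part2 T. u \<noteq> v \<longrightarrow> (u, v) \<in> ord2 T \<longrightarrow>
      (\<forall>x\<in>B u. \<forall>y\<in>B v. x \<noteq> y \<and> (x, y) \<in> ord2 G))"
    by (rule ordered_blocks) (use finT lin finA s_le parts A in auto)
  then obtain B2 where "\<forall>u\<in>part2 T. B2 u \<subseteq> A2 \<and> card (B2 u) = s"
    "\<forall>u\<in>part2 T. \<forall>v\<in>part2 T. u \<noteq> v \<longrightarrow> (u, v) \<in> ord2 T \<longrightarrow>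
      (\<forall>x\<in>B2 u. \<forall>y\<in>B2 v. x \<noteq> y \<and> (x, y) \<in> ord2 G)" by (elim exE conjE)
  then have B2: "\<And>u. u \<in> part2 T \<Longrightarrow> B2 u \<subseteq> A2" "\<And>u. u \<in> part2 T \<Longrightarrow> card (B2 u) = s"
    "\<And>u v x y. u \<in> part2 T \<Longrightarrow> v \<in> part2 T \<Longrightarrow> u \<noteq> v \<Longrightarrow> (u, v) \<in> ord2 T \<Longrightarrow>
      x \<in> B2 u \<Longrightarrow> y \<in> B2 v \<Longrightarrow> x \<noteq> y \<and> (x, y) \<in> ord2 G"
    by simp_all
  define B where "B u = (if u \<in> part1 T then B1 u else if u \<in> part2 T then B2 u else {})" for u
  have B_1: "B u = B1 u" if "u \<in> part1 T" for u using that by (simp add: B_def)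
  have B_2: "B u = B2 u" if "u \<in> part2 T" for u using that T.parts_disjoint by (auto simp: B_def)
  have dis1: "B1 u \<inter> B1 v = {}" if "u \<in> part1 T" "v \<in> part1 T" "u \<noteq> v" for u v
  proof -
    have "(u, v) \<in> ord1 T \<or> (v, u) \<in> ord1 T" using lin(1) that by (auto simp: total_on_def)
    then show ?thesis using B1(3)[of u v] B1(3)[of v u] that by blast
  qed
  have dis2: "B2 u \<inter> B2 v = {}" if "u \<in> part2 T" "v \<in> part2 T" "u \<noteq> v" for u v
  proof -
    have "(u, v) \<in> ord2 T \<or> (v, u) \<in> ord2 T" using lin(4) that by (auto simp: total_on_def)
    then show ?thesis using B2(3)[of u v] B2(3)[of v u] that by blast
  qed
  have A_dis: "A1 \<inter> A2 = {}" using A G.parts_disjoint by blast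
  have B_A: "B u \<subseteq> A1 \<and> u \<in> part1 T \<or> B u \<subseteq> A2 \<and> u \<in> part2 T - part1 T \<or> B u = {}" for u
    using B1(1) B2(1) T.parts_disjoint unfolding B_def by auto
  interpret blocks ?A "\<lambda>u. u \<in> part1 T" ?E B "A1 \<union> A2" \<Delta>
  proof
    show "(x, y) \<in> parcs (ugraph T) \<Longrightarrow> (y, x) \<in> parcs (ugraph T)" for x y
      by (rule T.arcs_symmetric)
    show "(x, y) \<in> parcs (ugraph T) \<Longrightarrow> (x \<in> part1 T) \<noteq> (y \<in> part1 T)" for x y
      using T.arcs_between_parts[of x y] T.parts_disjoint by blast
    show "(v, w) \<in> parcs (ugraph G) \<Longrightarrow> (w, v) \<in> parcs (ugraph G)" for v w
      by (rule G.arcs_symmetric)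
    show "(x \<in> part1 T) \<noteq> (y \<in> part1 T)"
      if "v \<in> B x" "w \<in> B y" "(v, w) \<in> parcs (ugraph G)" for v w x y
      using that B_A[of x] B_A[of y] A G.arcs_between_parts[of v w] G.parts_disjoint by blast
    show "finite (A1 \<union> A2)" using finA by simp
    show "B x \<subseteq> A1 \<union> A2" for x using B_A[of x] by blast
    show "B x \<inter> B y = {}" if "x \<noteq> y" for x y
      using that B_A[of x] B_A[of y] A_dis dis1[of x y] dis2[of x y] B_1 B_2 by blast
    show "real (card {w \<in> A1 \<union> A2. (v, w) \<in> parcs (ugraph G)}) \<le> \<Delta>" if "v \<in> A1 \<union> A2" for v
    proof (cases "v \<in> A1")
      case True
      then have "{w \<in> A1 \<union> A2. (v, w) \<in> parcs (ugraph G)} = {w \<in> A2. (v, w) \<in> parcs (ugraph G)}"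
        using A G.arcs_between_parts[of v] G.parts_disjoint by blast
      then show ?thesis using deg1[OF True] by simp
    next
      case False
      then have v: "v \<in> A2" using that by blast
      then have "{w \<in> A1 \<union> A2. (v, w) \<in> parcs (ugraph G)} = {w \<in> A1. (v, w) \<in> parcs (ugraph G)}"
        using A G.arcs_between_parts[of v] G.parts_disjoint by blast
      then show ?thesis using deg2[OF v] by simp
    qed
  qed
  define L where "L = loss t K \<Delta>"
  have L3: "real t ^ 3 \<le> L d" and L8: "real t ^ 8 \<le> L (Suc d)" for d
    unfolding L_def using loss_ge[OF tr \<Delta>(1) K, of d] by auto
  have L0: "0 < L d" for d
  proof -
    have "0 < real t ^ 3" using tr by simp
    then show ?thesis using L3[of d] by linarith
  qed
  define a where "a d = real t * m / L d" for d
  define q where "q d = max 1 (\<Delta> * L d powr - K)" for d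
  define \<gamma> where "\<gamma> = 6 * (real t - 1) * m / real t ^ 7"
  have a_Suc: "a (Suc d) = m * q d / (real t ^ 7 * \<Delta>)" for d
  proof -
    have "L (Suc d) = real t * (real t ^ 7 * \<Delta>) / q d"
      by (simp add: L_def q_def mult.assoc flip: power_Suc)
    then show ?thesis using tr by (simp add: a_def)
  qed
  have a7: "a (Suc d) \<le> m / real t ^ 7" for d
  proof -
    have "a (Suc d) \<le> real t * m / real t ^ 8"
      unfolding a_def using L8[of d] L0 m0 tr by (intro divide_left_mono) auto
    also have "\<dots> = m / real t ^ 7" using tr by (simp add: eval_nat_numeral)
    finally show ?thesis .
  qed
  have B_card: "m / real t \<le> real (card (B x))" if "x \<in> pverts (ugraph T)" for x
  proof -
    have "x \<in> part1 T \<or> x \<in> part2 T" using that T.parts_cover by blast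
    then have "card (B x) = s" using B1(2) B2(2) B_1 B_2 by metis
    then show ?thesis using s_ge by simp
  qed
  have "\<exists>v\<in>B \<rho>. extends (pverts (ugraph T)) \<rho> {} v"
  proof (rule rooted_copy[where b = "m / real t" and \<gamma> = \<gamma> and a = a and q = q and d = 0
        and \<rho> = "2 * m / real t ^ 3 + 2" and t = t and r = r])
    show "rooted_tree ?A r 0 \<rho> (pverts (ugraph T))" by fact
    show "card (pverts (ugraph T)) \<le> t" using t by simp
    show "m / real t \<le> real (card (B x))" if "x \<in> pverts (ugraph T)" for x using B_card[OF that] .
    show "\<exists>v\<in>D. q d \<le> real (card {w \<in> C. ?E v w})"
      if "d < r" "?A x y" "D \<subseteq> B x" "C \<subseteq> B y" "a d / real t \<le> real (card D)"
        "2 * m / real t ^ 3 + 2 \<le> real (card C)" for d x y D C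
    proof -
      have "D \<subseteq> A1 \<and> C \<subseteq> A2 \<or> D \<subseteq> A2 \<and> C \<subseteq> A1"
        using T.arcs_between_parts[OF that(2)]
      proof
        assume xy: "x \<in> part1 T \<and> y \<in> part2 T"
        then have "D \<subseteq> B1 x" "C \<subseteq> B2 y" using that(3,4) B_1[of x] B_2[of y] by simp_all
        then show ?thesis using B1(1)[of x] B2(1)[of y] xy by blast
      next
        assume xy: "x \<in> part2 T \<and> y \<in> part1 T"
        then have "D \<subseteq> B2 x" "C \<subseteq> B1 y" using that(3,4) B_2[of x] B_1[of y] by simp_all
        then show ?thesis using B2(1)[of x] B1(1)[of y] xy by blast
      qed
      moreover have "m / loss t K \<Delta> d \<le> real (card D)"
        using that(5) tr by (simp add: a_def L_def)
      ultimately show ?thesis using rob[OF that(1), of D C] that(6) by (simp add: q_def L_def)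
    qed
    show "0 < a d" for d using tr m0 L0 by (simp add: a_def)
    show "0 < q d" for d by (simp add: q_def)
    show "0 \<le> \<Delta>" using \<Delta> by simp
    show "0 \<le> \<gamma>" using tr m0 by (simp add: \<gamma>_def)
    show "6 * (real t - 1) * \<Delta> * a (Suc d) / q d \<le> \<gamma>" if "d < r" for d
    proof -
      have "0 < q d" by (simp add: q_def)
      then have "6 * (real t - 1) * \<Delta> * a (Suc d) / q d = \<gamma>"
        using tr \<Delta> by (simp add: a_Suc \<gamma>_def)
      then show ?thesis by simp
    qed
    show "3 * \<Delta> * (real t - 2) + \<gamma> * (real t - 1) + a (Suc d) + (2 * m / real t ^ 3 + 2) \<le> m / real t"
      if "d < r" for d
      unfolding \<gamma>_def by (rule block_budget[OF t(2) m \<Delta>(2) a7])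
    show "B \<rho> \<subseteq> B \<rho>" by simp
    show "a 0 \<le> real (card (B \<rho>))"
    proof -
      have "a 0 = (m / real t) / real t" using tr by (simp add: a_def L_def eval_nat_numeral)
      also have "\<dots> \<le> m / real t" using m0 tr by (simp add: divide_le_eq)
      finally show ?thesis using B_card[OF \<rho>] by linarith
    qed
    show "real (card ({} \<inter> B x)) \<le>
      (3 * \<Delta> + \<gamma>) * (real t - real (card (pverts (ugraph T))))" for x
      using t by simp
  qed
  then obtain f where f: "f \<rho> \<in> B \<rho>" "\<And>x. x \<in> pverts (ugraph T) - {\<rho>} \<Longrightarrow> f x \<in> B x - {}"
    "embeds (pverts (ugraph T)) f" unfolding extends_def by blast
  show ?thesis
  proof (rule contains_if_block_map[OF G T, where B = B and f = f])
    show "f u \<in> B u" if "u \<in> pverts (ugraph T)" for u using f that by (cases "u = \<rho>") auto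
    show "(f u, f v) \<in> parcs (ugraph G) \<longleftrightarrow> (u, v) \<in> parcs (ugraph T)"
      if "u \<in> pverts (ugraph T)" "v \<in> pverts (ugraph T)" for u v
      using f(3) that by (simp add: embeds_def)
    show "B u \<subseteq> part1 G" if "u \<in> part1 T" for u using B_1[OF that] B1(1)[OF that] A by blast
    show "B u \<subseteq> part2 G" if "u \<in> part2 T" for u using B_2[OF that] B2(1)[OF that] A by blast
    show "x \<noteq> y \<and> (x, y) \<in> ord1 G" if "u \<in> part1 T" "v \<in> part1 T" "u \<noteq> v" "(u, v) \<in> ord1 T"
      "x \<in> B u" "y \<in> B v" for u v x y
      using B1(3)[OF that(1-4)] that(5,6) B_1 that(1,2) by simp
    show "x \<noteq> y \<and> (x, y) \<in> ord2 G" if "u \<in> part2 T" "v \<in> part2 T" "u \<noteq> v" "(u, v) \<in> ord2 T"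
      "x \<in> B u" "y \<in> B v" for u v x y
      using B2(3)[OF that(1-4)] that(5,6) B_2 that(1,2) by simp
  qed
qed

text \<open>
  The radius is positive because a rooted tree with an edge has depth at least one; this makes
  \<open>K ^ r = K * K ^ (r - 1)\<close>.
\<close>

theorem mainTheorem1:
  fixes T :: "'a obigraph" and G :: "'b obigraph"
    and r t n :: nat and K :: real
  assumes "ordered_tree_bigraph T"
    and "radius (ugraph T) = r"
    and "card (pverts (ugraph T)) = t"
    and "t \<ge> 2"
    and "n \<ge> 1"
    and "ordered_bigraph G"
    and "\<not> contains G T"
    and "card (part1 G) \<ge> n"
    and "card (part2 G) \<ge> n"
    and "\<forall>v\<in>pverts (ugraph G).
      real (out_degree (with_proj (ugraph G)) v) \<le> real n / (4 * real t ^ 2)"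
    and "K \<ge> 0"
    and "real t powr (K ^ r) = real n"
  shows "\<exists>Z1 Z2. Z1 \<subseteq> part1 G \<and> Z2 \<subseteq> part2 G \<and>
    real (card Z1) \<ge> real n * real t powr (- 5 * K ^ (r - 1)) \<and>
    real (card Z2) \<ge> real n * real t powr (- 5 * K ^ (r - 1)) \<and>
    anticomplete (ugraph G) Z1 Z2"
proof -
  note t = \<open>card (pverts (ugraph T)) = t\<close> \<open>t \<ge> 2\<close>
  note G = \<open>ordered_bigraph G\<close>
  interpret G: ordered_bigraph G by fact
  have T: "ordered_bigraph T" and tree: "undirected_tree (ugraph T)"
    using assms(1) by (auto simp: ordered_tree_bigraph_def)
  interpret T: ordered_bigraph T by fact
  have "(x \<in> part1 T) \<noteq> (y \<in> part1 T)" if "(x, y) \<in> parcs (ugraph T)" for x y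
    using T.arcs_between_parts[OF that] T.parts_disjoint by blast
  from undirected_tree_rooted[of "ugraph T" "\<lambda>x. x \<in> part1 T", OF tree this]
  obtain \<rho> where \<rho>: "\<rho> \<in> pverts (ugraph T)"
    and rooted: "rooted_tree (\<lambda>x y. (x, y) \<in> parcs (ugraph T)) r 0 \<rho> (pverts (ugraph T))"
    using assms(2) by blast
  have r: "1 \<le> r" using rooted_tree_edge[OF rooted] t by simp
  have tr: "2 \<le> real t" using t by simp
  have fin: "finite (part1 G)" "finite (part2 G)"
    using G.parts_cover G.pair_finite_verts by (metis finite_Un)+
  have n0: "0 < real n" using \<open>n \<ge> 1\<close> by simp
  have ne: "part1 G \<noteq> {}" "part2 G \<noteq> {}" using assms(5,8,9) by auto
  define z where "z = real n * real t powr (- 5 * K ^ (r - 1))"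
  let ?E = "\<lambda>v w. (v, w) \<in> parcs (ugraph G)"
  have deg1: "real (card {w \<in> part2 G. ?E v w}) \<le> real n / (4 * real t ^ 2)" if "v \<in> part1 G" for v
  proof -
    obtain w where "w \<in> part2 G" using ne by blast
    moreover have "v \<in> pverts (ugraph G)" using that G.parts_cover by blast
    ultimately show ?thesis using G.degree_card(1)[OF that] assms(10) by metis
  qed
  have deg2: "real (card {w \<in> part1 G. ?E v w}) \<le> real n / (4 * real t ^ 2)" if "v \<in> part2 G" for v
  proof -
    obtain w where "w \<in> part1 G" using ne by blast
    moreover have "v \<in> pverts (ugraph G)" using that G.parts_cover by blast
    ultimately show ?thesis using G.degree_card(2)[OF _ that] assms(10) by metis
  qed
  have "\<exists>Z1 Z2. Z1 \<subseteq> part1 G \<and> Z2 \<subseteq> part2 G \<and> z \<le> real (card Z1) \<and> z \<le> real (card Z2) \<and>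
    \<not> (\<exists>x\<in>Z1. \<exists>y\<in>Z2. ?E x y)"
  proof (cases "K \<le> 5")
    case True
    have "K ^ r = K * K ^ (r - 1)" using r by (cases r) auto
    then have "K ^ r \<le> 5 * K ^ (r - 1)" using True \<open>K \<ge> 0\<close> by (simp add: mult_right_mono)
    then have "real n \<le> real t powr (5 * K ^ (r - 1))"
      unfolding assms(12)[symmetric] using tr by (intro powr_mono) auto
    then have z: "z \<le> 1" using tr by (simp add: z_def powr_minus divide_inverse[symmetric] divide_le_eq)
    obtain v where v: "v \<in> part1 G" using ne by blast
    have "card {w \<in> part2 G. ?E v w} < card (part2 G)"
    proof -
      have "1 \<le> real t ^ 2" using tr by (intro one_le_power) simp
      then have "1 < 4 * real t ^ 2" by linarith
      then have "real n / (4 * real t ^ 2) < real n" using n0 by (simp add: divide_less_eq)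
      then show ?thesis using deg1[OF v] assms(9) by linarith
    qed
    then have "{w \<in> part2 G. ?E v w} \<noteq> part2 G" by force
    then obtain w where "w \<in> part2 G" "\<not> ?E v w" by blast
    then show ?thesis using v z by (intro exI[of _ "{v}"] exI[of _ "{w}"]) simp
  next
    case False
    show ?thesis
    proof (rule ccontr)
      assume "\<not> ?thesis"
      then have no: "\<exists>x\<in>Z1. \<exists>y\<in>Z2. ?E x y"
        if "Z1 \<subseteq> part1 G" "Z2 \<subseteq> part2 G" "z \<le> real (card Z1)" "z \<le> real (card Z2)" for Z1 Z2
        using that by blast
      obtain m \<Delta> A1 A2 where *: "A1 \<subseteq> part1 G" "A2 \<subseteq> part2 G" "m \<le> real (card A1)" "m \<le> real (card A2)"
        "real t ^ 4 \<le> m" "1 \<le> \<Delta>" "\<Delta> \<le> m / (4 * real t ^ 2)"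
        "\<forall>v\<in>A1. real (card {w \<in> A2. ?E v w}) \<le> \<Delta>" "\<forall>v\<in>A2. real (card {w \<in> A1. ?E v w}) \<le> \<Delta>"
        "\<forall>d D C. d < r \<longrightarrow> D \<subseteq> A1 \<and> C \<subseteq> A2 \<or> D \<subseteq> A2 \<and> C \<subseteq> A1 \<longrightarrow>
          m / loss t K \<Delta> d \<le> real (card D) \<longrightarrow> 2 * m / real t ^ 3 + 2 \<le> real (card C) \<longrightarrow>
          (\<exists>v\<in>D. max 1 (\<Delta> * loss t K \<Delta> d powr - K) \<le> real (card {w \<in> C. ?E v w}))"
        using extremal_pair[OF fin G.arcs_symmetric assms(12) t(2) r _ assms(8,9) deg1 deg2 no[unfolded z_def]]
          False by (auto simp: not_le)
      have "contains G T"
        by (rule contains_if_robust[OF T rooted \<rho> t G *(1-7) \<open>K \<ge> 0\<close>]) (use *(8-10) in blast)+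
      then show False using assms(7) by simp
    qed
  qed
  then obtain Z1 Z2 where Z: "Z1 \<subseteq> part1 G" "Z2 \<subseteq> part2 G" "z \<le> real (card Z1)" "z \<le> real (card Z2)"
    "\<not> (\<exists>x\<in>Z1. \<exists>y\<in>Z2. ?E x y)" by (elim exE conjE)
  moreover have "Z1 \<inter> Z2 = {}" using Z(1,2) G.parts_disjoint by blast
  ultimately show ?thesis
    unfolding anticomplete_def z_def by (intro exI[of _ Z1] exI[of _ Z2] conjI) auto
qed

end
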